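(* Let $n\ge 1$ and let $\alpha_1,\dots,\alpha_n$ be infinite ordinals with Cantor normal forms without multiplicities $\alpha_i=\sum_{j<l_i}\omega^{\alpha_{i,j}}$, $\alpha_{i,0}\ge\alpha_{i,1}\ge\dots\ge\alpha_{i,l_i-1}$. Let $X=\alpha_1\times\dots\times\alpha_n$, let $Sl(X)=\{0,\dots,l_1-1\}\times\dots\times\{0,\dots,l_n-1\}$ and $Gr(X)=\{s\in Sl(X): s(k)=0 \text{ for some } k\in[1,n]\}$. For $s\in Sl(X)$ let $X_s=\omega^{\alpha_{1,s(1)}}\times\dots\times\omega^{\alpha_{n,s(n)}}$. Then $$\mathbf{w}(X)=\bigoplus_{s\in Gr(X)}\mathbf{w}(X_s).$$
   Context: Products of ordinals have the componentwise order. The width $\mathbf{w}(A)$ of a wqo $A$ is the rank of the forest of nonempty finite sequences of pairwise incomparable elements of $A$ ordered by initial segment. $\oplus$ is the natural (Hessenberg) sum. ($X_s$ is isomorphic to the "slice" of $X$ consisting of tuples whose $i$-th coordinate lies in $[\sum_{j<s(i)}\omega^{\alpha_{i,j}},\sum_{j\le s(i)}\omega^{\alpha_{i,j}})$.) *)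

theory Defs
  imports Main "HOL-Library.Multiset"
begin

text \<open>Ordinals are represented as well-order relations (Well_order r, carrier Field r);
equality of ordinals is ordIso, comparison is ordLeq (both from Main).\<close>

definition fin_supp :: "'b rel \<Rightarrow> ('b \<Rightarrow> nat) set" where
  "fin_supp r = {f. finite {x. f x \<noteq> 0} \<and> (\<forall>x. x \<notin> Field r \<longrightarrow> f x = 0)}"

definition oexp_omega :: "'b rel \<Rightarrow> ('b \<Rightarrow> nat) rel" where
  "oexp_omega r = {(f, g). f \<in> fin_supp r \<and> g \<in> fin_supp r \<and>
     (f = g \<or> (\<exists>x\<in>Field r. f x < g x \<and>
        (\<forall>y\<in>Field r. (x, y) \<in> r \<and> y \<noteq> x \<longrightarrow> f y = g y)))}"

definition osum_list :: "'c rel list \<Rightarrow> (nat \<times> 'c) rel" where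
  "osum_list rs = {((i, x), (j, y)). i < length rs \<and> j < length rs \<and>
     x \<in> Field (rs ! i) \<and> y \<in> Field (rs ! j) \<and> (i < j \<or> (i = j \<and> (x, y) \<in> rs ! i))}"

definition cnf :: "'c rel \<Rightarrow> 'c rel list \<Rightarrow> bool" where
  "cnf r es \<longleftrightarrow> (\<forall>e\<in>set es. Well_order e) \<and>
     (\<forall>k. Suc k < length es \<longrightarrow> (es ! Suc k, es ! k) \<in> ordLeq) \<and>
     (r, osum_list (map oexp_omega es)) \<in> ordIso"

definition natsum_is :: "'i set \<Rightarrow> ('i \<Rightarrow> 'c rel) \<Rightarrow> 'd rel \<Rightarrow> bool" where
  "natsum_is I F g \<longleftrightarrow> (\<exists>cs es. (\<forall>i\<in>I. cnf (F i) (cs i)) \<and>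
     mset es = (\<Sum>i\<in>I. mset (cs i)) \<and>
     (\<forall>e\<in>set es. Well_order e) \<and>
     (\<forall>k. Suc k < length es \<longrightarrow> (es ! Suc k, es ! k) \<in> ordLeq) \<and>
     (g, osum_list (map oexp_omega es)) \<in> ordIso)"

definition prod_carrier :: "nat \<Rightarrow> (nat \<Rightarrow> 'c rel) \<Rightarrow> (nat \<Rightarrow> 'c) set" where
  "prod_carrier n r = {x. (\<forall>i<n. x i \<in> Field (r i)) \<and> (\<forall>i\<ge>n. x i = undefined)}"

definition prod_le :: "nat \<Rightarrow> (nat \<Rightarrow> 'c rel) \<Rightarrow> (nat \<Rightarrow> 'c) rel" where
  "prod_le n r = {(x, y). x \<in> prod_carrier n r \<and> y \<in> prod_carrier n r \<and>
     (\<forall>i<n. (x i, y i) \<in> r i)}"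

definition inc_seqs :: "'x rel \<Rightarrow> 'x set \<Rightarrow> 'x list set" where
  "inc_seqs le A = {xs. xs \<noteq> [] \<and> set xs \<subseteq> A \<and>
     (\<forall>i<length xs. \<forall>j<length xs. i \<noteq> j \<longrightarrow> (xs ! i, xs ! j) \<notin> le)}"

text \<open>rank_fn T R g rho: rho is the rank function of the well-founded relation R on T
((y,x) in R means y is a child of x), with values in g:
rho x is the least element of g strictly above all rho y for children y,
and the set of attained values is all of Field g.  Then g is the rank of the forest,
i.e. sup of (rank x + 1).\<close>
definition rank_fn :: "'n set \<Rightarrow> 'n rel \<Rightarrow> 'm rel \<Rightarrow> ('n \<Rightarrow> 'm) \<Rightarrow> bool" where
  "rank_fn T R g rho \<longleftrightarrow> Well_order g \<and> rho ` T = Field g \<and>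
     (\<forall>x\<in>T. (\<forall>y\<in>T. (y, x) \<in> R \<longrightarrow> (rho y, rho x) \<in> g \<and> rho y \<noteq> rho x) \<and>
        (\<forall>z\<in>Field g. (\<forall>y\<in>T. (y, x) \<in> R \<longrightarrow> (rho y, z) \<in> g \<and> rho y \<noteq> z)
            \<longrightarrow> (rho x, z) \<in> g))"

definition width :: "'x rel \<Rightarrow> 'x set \<Rightarrow> 'x list set rel" where
  "width le A = (SOME g. \<exists>rho. rank_fn (inc_seqs le A)
      {(ys, xs). \<exists>zs. zs \<noteq> [] \<and> ys = xs @ zs} g rho)"

end

(*
  Upper bound: partition the slices of X into diagonals s, s + (1,...,1), s + (2,...,2), ... with s in
  Gr(X). The slices on a diagonal are stacked, so an antichain meets only one of them, and each embeds
  into the lowest one, X_s. Hence the rank of an antichain of X is bounded by the natural sum over Gr(X)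
  of the ranks of its traces.

  Lower bound: enumerate Gr(X) by decreasing width, refining the order on slices, and build an antichain
  by exhausting X_t for the last t first. When X_s is entered, every element y played so far lies in a
  slice t that is not below s; if s is below t, both have a common zero coordinate k, and playing in X_s
  only above the finitely many y(k) used keeps everything incomparable. This realises the ordinal sum of
  the widths, which is the natural sum because every w(X_s) is additively indecomposable: if x is in X_s
  and R is its residual, then a shifted copy of R, followed by a second copy whose coordinates not below
  x are moved above everything played, shows w(X_s) > w(R) + w(R).
*)

theory Submission
  imports Defs "HOL-Library.Multiset_Order" "HOL-Library.Infinite_Set"
begin

text \<open>The widths of the slices and the width of \<open>X\<close> are relations over different
  types, so ordinals cannot be added or compared directly. Comparisons are made by strictly monotone
  maps, and one well-order \<open>W\<close>, on a type large enough to contain every exponent as a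
  point, serves as a common scale: in \<open>oexp_omega W\<close> an ordinal is a finitely supported
  coefficient function, the power with exponent \<open>p\<close> is the segment below
  \<open>osingle p\<close>, and the natural sum is pointwise addition. Pointwise addition is
  strictly monotone in each summand, which is why the natural sum appears in the upper bound. The
  lower bound can only concatenate, so it yields an ordinal sum. The two meet because the summands
  are single powers listed in decreasing order; this is the role of indecomposability. Infinitude of
  the factors enters at one place: the leading block of each factor then has no largest element, so
  there is always room above finitely many points already played.\<close>

unbundle cardinal_syntax

section \<open>Well-orders\<close>

lemma underS_iff: "a \<in> underS r b \<longleftrightarrow> (a, b) \<in> r \<and> a \<noteq> b"
  by (auto simp: underS_def)

lemma Well_order_reflD: "Well_order r \<Longrightarrow> a \<in> Field r \<Longrightarrow> (a, a) \<in> r"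
  using wo_rel.REFL[of r] by (auto simp: wo_rel_def refl_on_def)

lemma Well_order_transD: "Well_order r \<Longrightarrow> (a, b) \<in> r \<Longrightarrow> (b, c) \<in> r \<Longrightarrow> (a, c) \<in> r"
  using wo_rel.TRANS[of r] by (auto simp: wo_rel_def dest: transD)

lemma Well_order_antisymD: "Well_order r \<Longrightarrow> (a, b) \<in> r \<Longrightarrow> (b, a) \<in> r \<Longrightarrow> a = b"
  using wo_rel.ANTISYM[of r] by (auto simp: wo_rel_def dest: antisymD)

lemma Well_order_cases:
  assumes "Well_order r" "a \<in> Field r" "b \<in> Field r"
  obtains "a = b" | "a \<in> underS r b" | "b \<in> underS r a"
  using assms wo_rel.TOTALS[of r] by (auto simp: wo_rel_def underS_iff)

lemma underS_trans': "Well_order r \<Longrightarrow> a \<in> underS r b \<Longrightarrow> b \<in> underS r c \<Longrightarrow> a \<in> underS r c"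
  unfolding underS_iff by (metis Well_order_antisymD Well_order_transD)

lemma underS_le_trans: "Well_order r \<Longrightarrow> a \<in> underS r b \<Longrightarrow> (b, c) \<in> r \<Longrightarrow> a \<in> underS r c"
  unfolding underS_iff by (metis Well_order_antisymD Well_order_transD)

lemma le_underS_trans: "Well_order r \<Longrightarrow> (a, b) \<in> r \<Longrightarrow> b \<in> underS r c \<Longrightarrow> a \<in> underS r c"
  unfolding underS_iff by (metis Well_order_antisymD Well_order_transD)

lemma underS_not_ge: "Well_order r \<Longrightarrow> a \<in> underS r b \<Longrightarrow> (b, a) \<notin> r"
  using Well_order_antisymD[of r a b] by (auto simp: underS_iff)

lemma not_underS_iff:
  "Well_order r \<Longrightarrow> a \<in> Field r \<Longrightarrow> b \<in> Field r \<Longrightarrow> a \<notin> underS r b \<longleftrightarrow> (b, a) \<in> r"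
  by (metis Well_order_antisymD Well_order_cases Well_order_reflD underS_iff)

lemma Well_order_least:
  assumes "Well_order r" "A \<subseteq> Field r" "A \<noteq> {}"
  obtains m where "m \<in> A" "\<forall>a\<in>A. (m, a) \<in> r"
  using wo_rel.minim_in[of r A] wo_rel.minim_least[of r A] assms unfolding wo_rel_def by blast

lemma Well_order_wf_underS: "Well_order r \<Longrightarrow> wf {(a, b). a \<in> underS r b}"
  by (rule wf_subset[of "r - Id"]) (auto simp: well_order_on_def underS_iff)

lemma Well_orderI:
  assumes "\<And>a. a \<in> Field r \<Longrightarrow> (a, a) \<in> r"
    and "\<And>a b c. (a, b) \<in> r \<Longrightarrow> (b, c) \<in> r \<Longrightarrow> (a, c) \<in> r"
    and "\<And>a b. (a, b) \<in> r \<Longrightarrow> (b, a) \<in> r \<Longrightarrow> a = b"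
    and "\<And>a b. a \<in> Field r \<Longrightarrow> b \<in> Field r \<Longrightarrow> (a, b) \<in> r \<or> (b, a) \<in> r"
    and "wf (r - Id)"
  shows "Well_order r"
proof -
  have "refl_on (Field r) r" using assms(1) unfolding refl_on_def by blast
  moreover have "trans r" using assms(2) unfolding trans_def by blast
  moreover have "antisym r" using assms(3) unfolding antisym_def by blast
  moreover have "total_on (Field r) r" using assms(4) unfolding total_on_def by blast
  moreover have "r \<subseteq> Field r \<times> Field r" by (auto simp: Field_def)
  ultimately show ?thesis
    using assms(5)
    unfolding well_order_on_def linear_order_on_def partial_order_on_def preorder_on_def by blast
qed

text \<open>Unlike for \<open>embed\<close>, the image need not be an initial segment, so such maps
  are easy to construct. Between well-orders their existence still amounts to \<open>\<le>o\<close>,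
  by \<open>ordLeq_strict_map\<close> and \<open>strict_map_ordLeq\<close>.\<close>

definition strict_map :: "'b rel \<Rightarrow> 'c rel \<Rightarrow> ('b \<Rightarrow> 'c) \<Rightarrow> bool" where
  "strict_map r r' f \<longleftrightarrow> (\<forall>a\<in>Field r. f a \<in> Field r') \<and>
     (\<forall>b\<in>Field r. \<forall>a\<in>underS r b. f a \<in> underS r' (f b))"

lemma strict_map_le:
  assumes "strict_map r r' f" "Well_order r'" "(a, b) \<in> r"
  shows "(f a, f b) \<in> r'"
  using assms FieldI2[OF assms(3)]
  by (metis Well_order_reflD strict_map_def underS_iff)

lemma strict_map_iff:
  assumes "strict_map r r' f" "Well_order r" "Well_order r'" "a \<in> Field r" "b \<in> Field r"
  shows "(f a, f b) \<in> r' \<longleftrightarrow> (a, b) \<in> r"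
  using assms strict_map_le[OF assms(1,3), of a b]
  by (metis Well_order_antisymD not_underS_iff strict_map_def underS_iff)

lemma strict_map_comp:
  "strict_map r r' f \<Longrightarrow> strict_map r' r'' g \<Longrightarrow> strict_map r r'' (g \<circ> f)"
  unfolding strict_map_def by auto

lemma underS_in_Field: "a \<in> underS r b \<Longrightarrow> a \<in> Field r \<and> b \<in> Field r"
  by (auto simp: underS_iff Field_def)

lemma ordLeq_strict_map:
  assumes "r \<le>o r'"
  obtains f where "strict_map r r' f"
proof -
  obtain f where f: "embed r r' f" and wo: "Well_order r" "Well_order r'"
    using assms unfolding ordLeq_def by blast
  have "strict_map r r' f"
    unfolding strict_map_def
  proof (intro conjI ballI)
    fix b assume b: "b \<in> Field r"
    show "f b \<in> Field r'" using embed_in_Field[OF f b] .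
    fix a assume a: "a \<in> underS r b"
    hence "(f a, f b) \<in> r'" using embed_compat[OF f] by (simp add: compat_def underS_iff)
    moreover have "f a \<noteq> f b"
      using inj_onD[OF embed_inj_on[OF wo(1) f]] a underS_in_Field[OF a] by (metis underS_iff)
    ultimately show "f a \<in> underS r' (f b)" by (simp add: underS_iff)
  qed
  thus ?thesis by (rule that)
qed

lemma Field_Restr_underS: "Well_order r \<Longrightarrow> Field (Restr r (underS r a)) = underS r a"
  by (simp add: Field_Restr_ofilter wo_rel.underS_ofilter wo_rel_def)

lemma underS_Restr:
  "b \<in> underS (Restr r A) c \<longleftrightarrow> b \<in> underS r c \<and> b \<in> A \<and> c \<in> A"
  by (auto simp: underS_iff)

text \<open>If \<open>f a\<close> were below \<open>a\<close>, the induction hypothesis at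
  \<open>f a\<close> would give \<open>f a \<le> f (f a)\<close>, whereas strictness puts
  \<open>f (f a)\<close> below \<open>f a\<close>.\<close>

lemma strict_map_increasing:
  assumes wo: "Well_order r" and f: "strict_map r r f" and a: "a \<in> Field r"
  shows "(a, f a) \<in> r"
  using a
proof (induction a rule: wf_induct_rule[OF Well_order_wf_underS[OF wo]])
  case (1 a)
  show ?case
  proof (rule ccontr)
    assume "(a, f a) \<notin> r"
    moreover have fa: "f a \<in> Field r" using f 1(2) by (auto simp: strict_map_def)
    ultimately have u: "f a \<in> underS r a" using not_underS_iff[OF wo fa 1(2)] by blast
    hence "(f a, f (f a)) \<in> r" using 1(1) fa by blast
    moreover have "f (f a) \<in> underS r (f a)" using f u 1(2) by (auto simp: strict_map_def)
    ultimately show False using underS_not_ge[OF wo] by blast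
  qed
qed

text \<open>Otherwise \<open>r'\<close> would be a proper initial segment of \<open>r\<close>, say
  below \<open>a\<close>, and composing with \<open>f\<close> would map \<open>r\<close> into that
  segment, moving \<open>a\<close> downwards.\<close>

lemma strict_map_ordLeq:
  assumes wo: "Well_order r" "Well_order r'" and f: "strict_map r r' f"
  shows "r \<le>o r'"
proof (rule ccontr)
  assume "\<not> r \<le>o r'"
  hence "r' <o r" using wo ordLess_or_ordLeq by blast
  then obtain a where a: "a \<in> Field r" "r' =o Restr r (underS r a)"
    using ordLess_iff_ordIso_Restr[OF wo] by blast
  obtain h where h: "strict_map r' (Restr r (underS r a)) h"
    using a(2) ordIso_imp_ordLeq ordLeq_strict_map by blast
  have hf: "strict_map r (Restr r (underS r a)) (h \<circ> f)"
    using strict_map_comp[OF f h] .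
  hence "strict_map r r (h \<circ> f)"
    by (auto simp: strict_map_def Field_Restr_underS[OF wo(1)] underS_Restr dest: underS_in_Field)
  hence "(a, (h \<circ> f) a) \<in> r" by (rule strict_map_increasing[OF wo(1) _ a(1)])
  moreover have "(h \<circ> f) a \<in> underS r a"
    using hf a(1) by (auto simp: strict_map_def Field_Restr_underS[OF wo(1)])
  ultimately show False using underS_not_ge[OF wo(1)] by blast
qed

lemma Restr_underS_ordLeq_iff:
  assumes wo: "Well_order r" and "a \<in> Field r" "b \<in> Field r"
  shows "Restr r (underS r a) \<le>o Restr r (underS r b) \<longleftrightarrow> (a, b) \<in> r"
proof -
  have "Restr r (underS r a) \<le>o Restr r (underS r b) \<longleftrightarrow> underS r a \<subseteq> underS r b"
    using ofilter_subset_ordLeq[OF wo, of "underS r a" "underS r b"]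
    by (simp add: wo_rel.underS_ofilter wo_rel_def wo)
  also have "\<dots> \<longleftrightarrow> (a, b) \<in> r"
  proof
    assume "underS r a \<subseteq> underS r b"
    thus "(a, b) \<in> r" using assms not_underS_iff[OF wo, of b a] by (auto simp: underS_iff)
  next
    assume "(a, b) \<in> r"
    thus "underS r a \<subseteq> underS r b" using underS_le_trans[OF wo] by blast
  qed
  finally show ?thesis .
qed

text \<open>Cantor's theorem: a strict map in the other direction would inject the sets over a type
  into that type. This supplies an ambient well-order in which every ordinal over the smaller type
  is a proper initial segment.\<close>

lemma ordLess_Well_order_UNIV_set:
  fixes g :: "'u rel" and W :: "'u set rel"
  assumes "Well_order g" "Well_order W" "Field W = UNIV"
  shows "g <o W"
proof (rule ccontr)
  assume "\<not> g <o W"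
  hence "W \<le>o g" using assms ordLess_or_ordLeq by blast
  then obtain f where "strict_map W g f" by (rule ordLeq_strict_map)
  hence "inj f" using assms unfolding inj_def
    by (metis UNIV_I Well_order_cases strict_map_def underS_iff)
  thus False using Cantors_theorem by (metis inv_f_f surjI Pow_UNIV)
qed

text \<open>\<open>cnf\<close> wants exponents over the same type as the ordinal itself. An ordinal
  constructed elsewhere can be moved to a given type once it is bounded by an ordinal there.\<close>

lemma ordLeq_transport:
  fixes g :: "'u rel" and r :: "'v rel"
  assumes "r \<le>o g"
  obtains e :: "'u rel" where "Well_order e" "r =o e"
  using assms internalize_ordLeq[of r g] unfolding ordIso_def by blast

lemma ex_Well_order_UNIV:
  obtains W :: "'v rel" where "Well_order W" "Field W = UNIV"
  using well_ordering[where 'a = 'v] well_order_on_Well_order by metis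

section \<open>Width of well-quasi-orders\<close>

definition incomp :: "'x rel \<Rightarrow> 'x \<Rightarrow> 'x \<Rightarrow> bool" where
  "incomp le x y \<longleftrightarrow> (x, y) \<notin> le \<and> (y, x) \<notin> le"

definition wqo :: "'x rel \<Rightarrow> 'x set \<Rightarrow> bool" where
  "wqo le A \<longleftrightarrow> (\<forall>f::nat \<Rightarrow> 'x. range f \<subseteq> A \<longrightarrow> (\<exists>i j. i < j \<and> (f i, f j) \<in> le))"

lemma wqo_subset: "wqo le A \<Longrightarrow> B \<subseteq> A \<Longrightarrow> wqo le B"
  unfolding wqo_def by blast

lemma inc_seqs_iff:
  "xs \<in> inc_seqs le A \<longleftrightarrow> xs \<noteq> [] \<and> set xs \<subseteq> A \<and> sorted_wrt (incomp le) xs"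
  unfolding inc_seqs_def sorted_wrt_iff_nth_less incomp_def
  by (auto) (metis linorder_neqE_nat)

abbreviation ext :: "'x list rel" where
  "ext \<equiv> {(ys, xs). \<exists>zs. zs \<noteq> [] \<and> ys = xs @ zs}"

text \<open>An infinite branch would spell out an infinite sequence of pairwise incomparable
  elements, which has no good pair. Its entry \<open>k\<close> is read off node \<open>k\<close>,
  whose length exceeds \<open>k\<close>.\<close>

lemma wf_inc_seqs:
  assumes "wqo le A"
  shows "wf {(ys, xs). ys \<in> inc_seqs le A \<and> xs \<in> inc_seqs le A \<and> (ys, xs) \<in> ext}"
  unfolding wf_iff_no_infinite_down_chain
proof
  assume "\<exists>c. \<forall>k. (c (Suc k), c k) \<in> {(ys, xs). ys \<in> inc_seqs le A \<and> xs \<in> inc_seqs le A \<and> (ys, xs) \<in> ext}"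
  then obtain c where T: "\<And>k. c k \<in> inc_seqs le A" and c: "\<And>k. \<exists>zs. zs \<noteq> [] \<and> c (Suc k) = c k @ zs"
    by blast
  have len: "k < length (c k)" for k
  proof (induction k)
    case 0 show ?case using T[of 0] by (simp add: inc_seqs_iff)
  next
    case (Suc k)
    obtain zs where zs: "zs \<noteq> []" "c (Suc k) = c k @ zs" using c by blast
    thus ?case using Suc.IH by (cases zs) auto
  qed
  have pre: "\<exists>zs. c (k + d) = c k @ zs" for k d
  proof (induction d)
    case (Suc d) thus ?case using c[of "k + d"] by auto
  qed simp
  define f where "f k = c k ! k" for k
  have fc: "f i = c j ! i" if "i \<le> j" for i j
    using pre[of i "j - i"] that len[of i] by (auto simp: f_def nth_append)
  have "f k \<in> A" for k
    using T[of k] nth_mem[OF len[of k]] unfolding f_def inc_seqs_iff by blast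
  hence "range f \<subseteq> A" by blast
  then obtain i j where ij: "i < j" "(f i, f j) \<in> le" using assms unfolding wqo_def by blast
  moreover have "(c j ! i, c j ! j) \<notin> le"
    using T[of j] len[of j] ij(1) unfolding inc_seqs_def by simp
  ultimately show False using fc[of i j] fc[of j j] by simp
qed

section \<open>Rank functions and the rank of the forest of antichains\<close>

lemma rank_fn_less:
  "rank_fn T R g rho \<Longrightarrow> x \<in> T \<Longrightarrow> y \<in> T \<Longrightarrow> (y, x) \<in> R \<Longrightarrow> rho y \<in> underS g (rho x)"
  unfolding rank_fn_def underS_iff by simp

text \<open>Among the values at least \<open>u\<close> that occur at descendants of
  \<open>x\<close>, take the least one, \<open>v\<close>. If \<open>v\<close> were not
  \<open>u\<close>, a descendant of the node carrying \<open>v\<close> would have a value at least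
  \<open>u\<close> but below \<open>v\<close>; by transitivity it is a descendant of
  \<open>x\<close> too.\<close>

lemma rank_fn_attained:
  assumes rho: "rank_fn T R g rho" and x: "x \<in> T" and u: "u \<in> underS g (rho x)"
    and tr: "\<And>x y z. x \<in> T \<Longrightarrow> y \<in> T \<Longrightarrow> z \<in> T \<Longrightarrow> (z, y) \<in> R \<Longrightarrow> (y, x) \<in> R \<Longrightarrow> (z, x) \<in> R"
  obtains y where "y \<in> T" "(y, x) \<in> R" "rho y = u"
proof -
  have wo: "Well_order g" using rho by (simp add: rank_fn_def)
  define V where "V = {v. (u, v) \<in> g \<and> (\<exists>y\<in>T. (y, x) \<in> R \<and> rho y = v)}"
  have "\<not> (rho x, u) \<in> g" using underS_not_ge[OF wo u] .
  moreover have "u \<in> Field g" using u by (auto dest: underS_in_Field)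
  ultimately obtain y where y: "y \<in> T" "(y, x) \<in> R" "rho y \<notin> underS g u"
    using rho x unfolding rank_fn_def underS_iff by blast
  have fld: "\<And>y. y \<in> T \<Longrightarrow> rho y \<in> Field g" using rho unfolding rank_fn_def by blast
  have "(u, rho y) \<in> g" using y fld \<open>u \<in> Field g\<close> not_underS_iff[OF wo] by blast
  hence "rho y \<in> V" using y by (auto simp: V_def)
  moreover have "V \<subseteq> Field g" by (auto simp: V_def Field_def)
  ultimately obtain v where v: "v \<in> V" "\<forall>a\<in>V. (v, a) \<in> g"
    using Well_order_least[OF wo, of V] by blast
  then obtain z where z: "z \<in> T" "(z, x) \<in> R" "rho z = v" "(u, v) \<in> g" by (auto simp: V_def)
  have "v = u"
  proof (rule ccontr)
    assume "v \<noteq> u"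
    hence "u \<in> underS g (rho z)" using z by (auto simp: underS_iff)
    hence "\<not> (rho z, u) \<in> g" using underS_not_ge[OF wo] by blast
    then obtain w where w: "w \<in> T" "(w, z) \<in> R" "rho w \<notin> underS g u"
      using rho z(1) \<open>u \<in> Field g\<close> unfolding rank_fn_def underS_iff by blast
    have "(u, rho w) \<in> g" using w fld \<open>u \<in> Field g\<close> not_underS_iff[OF wo] by blast
    moreover have "(w, x) \<in> R" using tr x z w by blast
    ultimately have "rho w \<in> V" using w by (auto simp: V_def)
    hence "(v, rho w) \<in> g" using v by blast
    moreover have "rho w \<in> underS g v" using rank_fn_less[OF rho z(1) w(1,2)] z(3) by simp
    ultimately show False using underS_not_ge[OF wo] by blast
  qed
  thus ?thesis using that z by blast
qed

text \<open>Ranks are defined by recursion, with values in a well-order of all sets of nodes. By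
  Cantor the nodes cannot exhaust these values, so a strict upper bound always remains. It is also
  the type in which \<open>width\<close> makes its choice.\<close>

lemma rank_fn_exists:
  fixes T :: "'n set" and R :: "'n rel"
  assumes wf: "wf {(y, x). y \<in> T \<and> x \<in> T \<and> (y, x) \<in> R}"
    and tr: "\<And>x y z. x \<in> T \<Longrightarrow> y \<in> T \<Longrightarrow> z \<in> T \<Longrightarrow> (z, y) \<in> R \<Longrightarrow> (y, x) \<in> R \<Longrightarrow> (z, x) \<in> R"
  shows "\<exists>(g :: 'n set rel) rho. rank_fn T R g rho"
proof -
  obtain W :: "'n set rel" where W: "Well_order W" "Field W = UNIV"
    by (rule ex_Well_order_UNIV)
  define S where "S = {(y, x). y \<in> T \<and> x \<in> T \<and> (y, x) \<in> R}"
  have wf: "wf S" using wf unfolding S_def .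
  have S_iff: "(y, x) \<in> S \<longleftrightarrow> y \<in> T \<and> x \<in> T \<and> (y, x) \<in> R" for x y by (simp add: S_def)
  have tr: "(z, x) \<in> S" if "(z, y) \<in> S" "(y, x) \<in> S" for x y z
    using that tr[of x y z] by (simp add: S_iff)
  define above where "above B = {w. \<forall>b\<in>B. b \<in> underS W w}" for B :: "'n set set"
  define rho where "rho = wfrec S (\<lambda>h x. wo_rel.minim W (above (h ` {y. (y, x) \<in> S})))"
  have rho: "rho x = wo_rel.minim W (above (rho ` {y. (y, x) \<in> S}))" for x
  proof -
    have "rho x = wo_rel.minim W (above (cut rho S x ` {y. (y, x) \<in> S}))"
      unfolding rho_def by (subst wfrec[OF wf]) simp
    also have "cut rho S x ` {y. (y, x) \<in> S} = rho ` {y. (y, x) \<in> S}"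
      by (auto simp: cut_def image_def)
    finally show ?thesis .
  qed
  \<comment> \<open>The two claims need each other: the values at the predecessors of
    \<open>x\<close> are downward closed by induction, so if no strict upper bound existed, every
    element of \<open>W\<close> would be a value. Conversely the least strict upper bound leaves no
    gap below \<open>rho x\<close>.\<close>
  have key: "above (rho ` {y. (y, x) \<in> S}) \<noteq> {} \<and> (\<forall>u\<in>underS W (rho x). \<exists>y. (y, x) \<in> S \<and> rho y = u)" for x
  proof (induction x rule: wf_induct_rule[OF wf])
    case (1 x)
    let ?C = "rho ` {y. (y, x) \<in> S}"
    have down: "u \<in> ?C" if "b \<in> ?C" "u \<in> underS W b" for u b
    proof -
      obtain y where y: "(y, x) \<in> S" "b = rho y" using \<open>b \<in> ?C\<close> by blast
      hence "u \<in> underS W (rho y)" using that(2) by simp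
      then obtain z where z: "(z, y) \<in> S" "rho z = u"
        using bspec[OF conjunct2[OF 1[OF y(1)]]] by blast
      have "(z, x) \<in> S" using y z tr[of z y x] by simp
      thus ?thesis using z by blast
    qed
    have ne: "above ?C \<noteq> {}"
    proof
      assume e: "above ?C = {}"
      have inC: "w \<in> ?C" for w
      proof -
        have "w \<notin> above ?C" using e by simp
        then obtain b where "b \<in> ?C" "b \<notin> underS W w"
          unfolding above_def mem_Collect_eq Ball_def by blast
        thus ?thesis using down[of b w] Well_order_cases[OF W(1), of b w] W(2) by (metis UNIV_I)
      qed
      have "rho ` UNIV = Pow UNIV" using inC by (metis Pow_UNIV UNIV_eq_I image_mono subset_UNIV subsetD)
      thus False using Cantors_theorem by metis
    qed
    moreover have "u \<in> ?C" if u: "u \<in> underS W (rho x)" for u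
    proof (rule ccontr)
      assume n: "u \<notin> ?C"
      have "u \<in> above ?C"
        unfolding above_def
      proof (intro CollectI ballI)
        fix b assume b: "b \<in> ?C"
        show "b \<in> underS W u"
          using Well_order_cases[OF W(1), of b u] W(2) down[OF b] b n by (metis UNIV_I)
      qed
      hence "(rho x, u) \<in> W" unfolding rho[of x] using wo_rel.minim_least[of W "above ?C" u] W
        by (simp add: wo_rel_def)
      thus False using underS_not_ge[OF W(1) u] by blast
    qed
    ultimately show ?case by blast
  qed
  have lt: "rho y \<in> underS W (rho x)" if "(y, x) \<in> S" for x y
  proof -
    let ?C = "rho ` {y. (y, x) \<in> S}"
    have "rho x \<in> above ?C" unfolding rho[of x]
      using wo_rel.minim_in[of W "above ?C"] W key[of x] by (simp add: wo_rel_def)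
    thus ?thesis using that unfolding above_def by blast
  qed
  \<comment> \<open>Cut down to the values that occur, so that \<open>g\<close> is the rank itself
    and not merely an upper bound.\<close>
  define g where "g = Restr W (rho ` T)"
  have wog: "Well_order g" unfolding g_def using W(1) by (rule Well_order_Restr)
  have fg: "Field g = rho ` T" unfolding g_def
    by (rule Refl_Field_Restr2) (use W wo_rel.REFL[of W] in \<open>simp_all add: wo_rel_def\<close>)
  have "rank_fn T R g rho"
    unfolding rank_fn_def
  proof (intro conjI ballI impI)
    fix x y assume "x \<in> T" "y \<in> T" "(y, x) \<in> R"
    hence "rho y \<in> underS W (rho x)" using lt by (simp add: S_iff)
    thus "(rho y, rho x) \<in> g" "rho y \<noteq> rho x" using \<open>x \<in> T\<close> \<open>y \<in> T\<close> by (auto simp: g_def underS_iff)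
  next
    fix x z assume x: "x \<in> T" and z: "z \<in> Field g"
      and *: "\<forall>y\<in>T. (y, x) \<in> R \<longrightarrow> (rho y, z) \<in> g \<and> rho y \<noteq> z"
    have "z \<in> above (rho ` {y. (y, x) \<in> S})"
      unfolding above_def using * by (auto simp: g_def underS_iff S_iff)
    hence "(rho x, z) \<in> W" unfolding rho[of x] using wo_rel.minim_least[of W _ z] W
      by (simp add: wo_rel_def)
    thus "(rho x, z) \<in> g" using x z fg by (auto simp: g_def)
  qed (use wog fg in auto)
  thus ?thesis by blast
qed

lemma ext_trans: "(zs, ys) \<in> ext \<Longrightarrow> (ys, xs) \<in> ext \<Longrightarrow> (zs, xs) \<in> ext"
  unfolding mem_Collect_eq prod.case by (metis append.assoc append_is_Nil_conv)

lemma rank_fn_width: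
  assumes "wqo le A"
  shows "\<exists>rho. rank_fn (inc_seqs le A) ext (width le A) rho"
proof -
  have "\<exists>(g :: 'a list set rel) rho. rank_fn (inc_seqs le A) ext g rho"
    using wf_inc_seqs[OF assms] ext_trans by (rule rank_fn_exists)
  thus ?thesis unfolding width_def by (rule someI_ex)
qed

definition width_rank :: "'x rel \<Rightarrow> 'x set \<Rightarrow> 'x list \<Rightarrow> 'x list set" where
  "width_rank le A = (SOME rho. rank_fn (inc_seqs le A) ext (width le A) rho)"

lemma width_rank:
  assumes "wqo le A"
  shows "Well_order (width le A)"
    and "width_rank le A ` inc_seqs le A = Field (width le A)"
    and "\<And>xs zs. xs \<in> inc_seqs le A \<Longrightarrow> xs @ zs \<in> inc_seqs le A \<Longrightarrow> zs \<noteq> [] \<Longrightarrow>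
      width_rank le A (xs @ zs) \<in> underS (width le A) (width_rank le A xs)"
    and "\<And>xs u. xs \<in> inc_seqs le A \<Longrightarrow> u \<in> underS (width le A) (width_rank le A xs) \<Longrightarrow>
      \<exists>zs. zs \<noteq> [] \<and> xs @ zs \<in> inc_seqs le A \<and> width_rank le A (xs @ zs) = u"
proof -
  have r: "rank_fn (inc_seqs le A) ext (width le A) (width_rank le A)"
    unfolding width_rank_def using rank_fn_width[OF assms] by (rule someI_ex)
  show "Well_order (width le A)" "width_rank le A ` inc_seqs le A = Field (width le A)"
    using r unfolding rank_fn_def by auto
  show "width_rank le A (xs @ zs) \<in> underS (width le A) (width_rank le A xs)"
    if "xs \<in> inc_seqs le A" "xs @ zs \<in> inc_seqs le A" "zs \<noteq> []" for xs zs
    using rank_fn_less[OF r that(1,2)] that(3) by simp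
  show "\<exists>zs. zs \<noteq> [] \<and> xs @ zs \<in> inc_seqs le A \<and> width_rank le A (xs @ zs) = u"
    if u: "xs \<in> inc_seqs le A" "u \<in> underS (width le A) (width_rank le A xs)" for xs u
  proof -
    obtain ys where "ys \<in> inc_seqs le A" "(ys, xs) \<in> ext" "width_rank le A ys = u"
    proof (rule rank_fn_attained[OF r u])
      show "(z, x) \<in> ext" if "(z, y) \<in> ext" "(y, x) \<in> ext" for x y z :: "'a list"
        using that by (rule ext_trans)
    qed (rule that)
    thus ?thesis by blast
  qed
qed

text \<open>A labelling that drops at every one-element extension dominates the rank. Each rank is
  sent to the least label of its nodes: a node with the least label for \<open>v\<close> has a
  descendant of every smaller rank, and that descendant has a smaller label.\<close>

lemma width_upper:
  assumes wqo: "wqo le A" and wo: "Well_order r"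
    and fld: "\<And>xs. xs \<in> inc_seqs le A \<Longrightarrow> \<sigma> xs \<in> Field r"
    and step: "\<And>xs z. xs \<in> inc_seqs le A \<Longrightarrow> xs @ [z] \<in> inc_seqs le A \<Longrightarrow> \<sigma> (xs @ [z]) \<in> underS r (\<sigma> xs)"
  shows "width le A \<le>o r"
proof -
  let ?T = "inc_seqs le A" let ?g = "width le A" let ?rho = "width_rank le A"
  have dec: "\<sigma> (xs @ zs) \<in> underS r (\<sigma> xs)" if "xs \<in> ?T" "xs @ zs \<in> ?T" "zs \<noteq> []" for xs zs
    using that(3,2)
  proof (induction zs rule: rev_nonempty_induct)
    case (single z) thus ?case using step that(1) by blast
  next
    case (snoc z zs)
    have 1: "xs @ zs \<in> ?T" using snoc by (auto simp: inc_seqs_iff sorted_wrt_append)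
    hence "\<sigma> ((xs @ zs) @ [z]) \<in> underS r (\<sigma> (xs @ zs))"
      using step[OF 1, of z] snoc(3) by auto
    thus ?case using snoc 1 underS_trans'[OF wo] by auto
  qed
  define f where "f v = wo_rel.minim r (\<sigma> ` {xs \<in> ?T. ?rho xs = v})" for v
  have f: "f v \<in> \<sigma> ` {xs \<in> ?T. ?rho xs = v}" "\<And>xs. xs \<in> ?T \<Longrightarrow> ?rho xs = v \<Longrightarrow> (f v, \<sigma> xs) \<in> r"
    if "v \<in> Field ?g" for v
  proof -
    let ?M = "\<sigma> ` {xs \<in> ?T. ?rho xs = v}"
    have "?M \<noteq> {}" using that unfolding width_rank(2)[OF wqo, symmetric] by blast
    moreover have "?M \<subseteq> Field r" using fld by blast
    ultimately show "f v \<in> ?M" "\<And>xs. xs \<in> ?T \<Longrightarrow> ?rho xs = v \<Longrightarrow> (f v, \<sigma> xs) \<in> r"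
      unfolding f_def using wo_rel.minim_in[of r ?M] wo_rel.minim_least[of r ?M] wo
      by (auto simp: wo_rel_def)
  qed
  have "strict_map ?g r f"
    unfolding strict_map_def
  proof (intro conjI ballI)
    fix v assume v: "v \<in> Field ?g"
    then obtain xs where xs: "xs \<in> ?T" "?rho xs = v" "f v = \<sigma> xs" using f(1) by auto
    show "f v \<in> Field r" using fld xs by simp
    fix u assume u: "u \<in> underS ?g v"
    from xs obtain zs where zs: "zs \<noteq> []" "xs @ zs \<in> ?T" "?rho (xs @ zs) = u"
      using width_rank(4)[OF wqo xs(1)] u by blast
    have "(f u, \<sigma> (xs @ zs)) \<in> r" using f(2) zs u by (blast dest: underS_in_Field)
    moreover have "\<sigma> (xs @ zs) \<in> underS r (\<sigma> xs)" using dec xs zs by blast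
    ultimately show "f u \<in> underS r (f v)" using xs le_underS_trans[OF wo] by simp
  qed
  thus ?thesis using strict_map_ordLeq width_rank(1)[OF wqo] wo by blast
qed

text \<open>Read \<open>P xs v\<close> as: after \<open>xs\<close> has been played, the value
  \<open>v\<close> is still in reserve. If every smaller reserve can be reached by playing on, then
  sending \<open>v\<close> to the least rank of a position with reserve \<open>v\<close> is strictly
  monotone. Several elements may be played in one step.\<close>

lemma width_lower:
  assumes wqo: "wqo le A" and wo: "Well_order r"
    and start: "\<And>v. v \<in> Field r \<Longrightarrow> \<exists>xs\<in>inc_seqs le A. P xs v"
    and step: "\<And>xs u v. xs \<in> inc_seqs le A \<Longrightarrow> P xs v \<Longrightarrow> u \<in> underS r v \<Longrightarrow>
       \<exists>zs. zs \<noteq> [] \<and> xs @ zs \<in> inc_seqs le A \<and> P (xs @ zs) u"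
  shows "r \<le>o width le A"
proof -
  let ?T = "inc_seqs le A" let ?g = "width le A" let ?rho = "width_rank le A"
  have wog: "Well_order ?g" using width_rank(1)[OF wqo] .
  define f where "f v = wo_rel.minim ?g (?rho ` {xs \<in> ?T. P xs v})" for v
  have f: "f v \<in> ?rho ` {xs \<in> ?T. P xs v}" "\<And>xs. xs \<in> ?T \<Longrightarrow> P xs v \<Longrightarrow> (f v, ?rho xs) \<in> ?g"
    if "v \<in> Field r" for v
  proof -
    let ?M = "?rho ` {xs \<in> ?T. P xs v}"
    have "?M \<noteq> {}" using start[OF that] by blast
    moreover have "?M \<subseteq> Field ?g" using width_rank(2)[OF wqo] by blast
    ultimately show "f v \<in> ?M" "\<And>xs. xs \<in> ?T \<Longrightarrow> P xs v \<Longrightarrow> (f v, ?rho xs) \<in> ?g"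
      unfolding f_def using wo_rel.minim_in[of ?g ?M] wo_rel.minim_least[of ?g ?M] wog
      by (auto simp: wo_rel_def)
  qed
  have "strict_map r ?g f"
    unfolding strict_map_def
  proof (intro conjI ballI)
    fix v assume v: "v \<in> Field r"
    then obtain xs where xs: "xs \<in> ?T" "P xs v" "f v = ?rho xs" using f(1) by auto
    show "f v \<in> Field ?g" using xs unfolding width_rank(2)[OF wqo, symmetric] by simp
    fix u assume u: "u \<in> underS r v"
    from xs obtain zs where zs: "zs \<noteq> []" "xs @ zs \<in> ?T" "P (xs @ zs) u" using step u by blast
    have "(f u, ?rho (xs @ zs)) \<in> ?g" using f(2) zs u by (blast dest: underS_in_Field)
    moreover have "?rho (xs @ zs) \<in> underS ?g (?rho xs)" using width_rank(3)[OF wqo] xs zs by blast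
    ultimately show "f u \<in> underS ?g (f v)" using xs le_underS_trans[OF wog] by simp
  qed
  thus ?thesis using strict_map_ordLeq wog wo by blast
qed

lemma inc_seqs_map:
  assumes "xs \<in> inc_seqs le A" "f ` A \<subseteq> B"
    and "\<And>x y. x \<in> A \<Longrightarrow> y \<in> A \<Longrightarrow> incomp le x y \<Longrightarrow> incomp le' (f x) (f y)"
  shows "map f xs \<in> inc_seqs le' B"
proof -
  have xs: "xs \<noteq> []" "set xs \<subseteq> A" "sorted_wrt (incomp le) xs" using assms(1) by (auto simp: inc_seqs_iff)
  have "sorted_wrt (\<lambda>x y. incomp le' (f x) (f y)) xs"
    using xs(2,3) assms(3) by (intro sorted_wrt_mono_rel[OF _ xs(3)]) blast
  thus ?thesis using xs assms(2) unfolding inc_seqs_iff sorted_wrt_map by auto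
qed

text \<open>Antichains of \<open>A\<close> are copied entry by entry to \<open>B\<close>. Comparable
  elements may go anywhere, so \<open>f\<close> need not be monotone.\<close>

lemma width_mono:
  assumes wqo: "wqo le A" "wqo le' B" and f: "f ` A \<subseteq> B"
    and inc: "\<And>x y. x \<in> A \<Longrightarrow> y \<in> A \<Longrightarrow> incomp le x y \<Longrightarrow> incomp le' (f x) (f y)"
  shows "width le A \<le>o width le' B"
proof (rule width_upper[OF wqo(1) width_rank(1)[OF wqo(2)], of "\<lambda>xs. width_rank le' B (map f xs)"])
  note m = inc_seqs_map[OF _ f inc]
  show "width_rank le' B (map f xs) \<in> Field (width le' B)" if "xs \<in> inc_seqs le A" for xs
    unfolding width_rank(2)[OF wqo(2), symmetric] using m[OF that] by blast
  show "width_rank le' B (map f (xs @ [z])) \<in> underS (width le' B) (width_rank le' B (map f xs))"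
    if "xs \<in> inc_seqs le A" "xs @ [z] \<in> inc_seqs le A" for xs z
    using width_rank(3)[OF wqo(2), of "map f xs" "[f z]"] m[OF that(1)] m[OF that(2)] by simp
qed

text \<open>A node of rank \<open>\<gamma>\<close> begins with some \<open>x\<close>, and its root
  \<open>[x]\<close> has rank at least \<open>\<gamma>\<close>. Every continuation of
  \<open>[x]\<close> is played in the residual of \<open>x\<close>, so the residual realises all
  ranks below \<open>\<gamma>\<close>.\<close>

lemma underS_width_ordLeq:
  assumes wqo: "wqo le A" and \<gamma>: "\<gamma> \<in> Field (width le A)"
  obtains x where "x \<in> A"
    "Restr (width le A) (underS (width le A) \<gamma>) \<le>o width le {y \<in> A. incomp le x y}"
proof -
  let ?g = "width le A" let ?rho = "width_rank le A"
  have wog: "Well_order ?g" using width_rank(1)[OF wqo] .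
  obtain xs where xs: "xs \<in> inc_seqs le A" "?rho xs = \<gamma>" using \<gamma> unfolding width_rank(2)[OF wqo, symmetric] by blast
  then obtain x ys where xys: "xs = [x] @ ys" by (cases xs) (auto simp: inc_seqs_iff)
  have x1: "[x] \<in> inc_seqs le A" using xs xys by (auto simp: inc_seqs_iff)
  have le: "(\<gamma>, ?rho [x]) \<in> ?g"
  proof (cases "ys = []")
    case True thus ?thesis using xs xys \<gamma> Well_order_reflD[OF wog] by auto
  next
    case False
    thus ?thesis using width_rank(3)[OF wqo x1, of ys] xs unfolding xys underS_iff by blast
  qed
  let ?C = "{y \<in> A. incomp le x y}"
  have C: "zs \<in> inc_seqs le ?C \<longleftrightarrow> zs \<noteq> [] \<and> [x] @ zs \<in> inc_seqs le A" for zs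
    using x1 by (auto simp: inc_seqs_iff)
  have "Restr ?g (underS ?g \<gamma>) \<le>o width le ?C"
  proof (rule width_lower[OF wqo_subset[OF wqo] Well_order_Restr[OF wog], of _ _ "\<lambda>zs v. v = ?rho ([x] @ zs)"])
    show "?C \<subseteq> A" by blast
    fix v assume "v \<in> Field (Restr ?g (underS ?g \<gamma>))"
    hence "v \<in> underS ?g (?rho [x])"
      using le Field_Restr_underS[OF wog] underS_le_trans[OF wog] by blast
    thus "\<exists>xs\<in>inc_seqs le ?C. v = ?rho ([x] @ xs)"
      using width_rank(4)[OF wqo x1] C by metis
  next
    fix zs u v assume zs: "zs \<in> inc_seqs le ?C" "v = ?rho ([x] @ zs)"
      "u \<in> underS (Restr ?g (underS ?g \<gamma>)) v"
    have "u \<in> underS ?g (?rho ([x] @ zs))" using zs by (auto simp: underS_Restr)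
    moreover have "[x] @ zs \<in> inc_seqs le A" using zs C by blast
    ultimately obtain ws where "ws \<noteq> []" "([x] @ zs) @ ws \<in> inc_seqs le A" "?rho (([x] @ zs) @ ws) = u"
      using width_rank(4)[OF wqo] by blast
    thus "\<exists>ws. ws \<noteq> [] \<and> zs @ ws \<in> inc_seqs le ?C \<and> u = ?rho ([x] @ zs @ ws)"
      using C[of "zs @ ws"] by (intro exI[of _ ws]) auto
  qed
  moreover have "x \<in> A" using x1 by (auto simp: inc_seqs_iff)
  ultimately show ?thesis using that by blast
qed

section \<open>Powers of omega\<close>

text \<open>A function in \<open>fin_supp r\<close> is a Cantor normal form with coefficient
  \<open>f x\<close> at the exponent \<open>x\<close>; two such forms are compared at the largest
  exponent where they differ.\<close>

definition omega_less :: "'b rel \<Rightarrow> ('b \<Rightarrow> nat) \<Rightarrow> ('b \<Rightarrow> nat) \<Rightarrow> bool" where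
  "omega_less r f g \<longleftrightarrow> (\<exists>x\<in>Field r. f x < g x \<and> (\<forall>y\<in>Field r. x \<in> underS r y \<longrightarrow> f y = g y))"

lemma oexp_omega_iff:
  "(f, g) \<in> oexp_omega r \<longleftrightarrow> f \<in> fin_supp r \<and> g \<in> fin_supp r \<and> (f = g \<or> omega_less r f g)"
  unfolding oexp_omega_def omega_less_def underS_iff by (auto simp: eq_commute)

lemma omega_less_irrefl: "\<not> omega_less r f f"
  by (auto simp: omega_less_def)

lemma underS_oexp_omega:
  "f \<in> underS (oexp_omega r) g \<longleftrightarrow> f \<in> fin_supp r \<and> g \<in> fin_supp r \<and> omega_less r f g"
  unfolding underS_iff oexp_omega_iff using omega_less_irrefl[of r] by auto

lemma Field_oexp_omega: "Field (oexp_omega r) = fin_supp r"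
  by (auto simp: Field_def oexp_omega_iff)

lemma omega_less_trans:
  assumes wo: "Well_order r" and "omega_less r f g" "omega_less r g h"
  shows "omega_less r f h"
proof -
  obtain x where x: "x \<in> Field r" "f x < g x" "\<And>y. y \<in> Field r \<Longrightarrow> x \<in> underS r y \<Longrightarrow> f y = g y"
    using assms(2) unfolding omega_less_def by blast
  obtain z where z: "z \<in> Field r" "g z < h z" "\<And>y. y \<in> Field r \<Longrightarrow> z \<in> underS r y \<Longrightarrow> g y = h y"
    using assms(3) unfolding omega_less_def by blast
  show ?thesis
  proof (cases rule: Well_order_cases[OF wo x(1) z(1)])
    case 1 thus ?thesis using x z unfolding omega_less_def by (metis order.strict_trans)
  next
    case 2
    hence "f z < h z" using x(3)[OF z(1)] z(2) by simp
    moreover have "f y = h y" if "y \<in> Field r" "z \<in> underS r y" for y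
      using x(3)[OF that(1)] z(3)[OF that] underS_trans'[OF wo 2 that(2)] by simp
    ultimately show ?thesis using z(1) unfolding omega_less_def by blast
  next
    case 3
    hence "f x < h x" using z(3)[OF x(1)] x(2) by simp
    moreover have "f y = h y" if "y \<in> Field r" "x \<in> underS r y" for y
      using z(3)[OF that(1)] x(3)[OF that] underS_trans'[OF wo 3 that(2)] by simp
    ultimately show ?thesis using x(1) unfolding omega_less_def by blast
  qed
qed

lemma Well_order_greatest_finite:
  assumes wo: "Well_order r" and "finite D" "D \<noteq> {}" "D \<subseteq> Field r"
  obtains x where "x \<in> D" "\<And>y. y \<in> D \<Longrightarrow> (y, x) \<in> r"
proof -
  have "\<exists>x\<in>D. \<forall>y\<in>D. (y, x) \<in> r"
    using assms(2,3,4)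
  proof (induction D rule: finite_ne_induct)
    case (singleton a) thus ?case using Well_order_reflD[OF wo] by simp
  next
    case (insert a D)
    then obtain x where x: "x \<in> D" "\<forall>y\<in>D. (y, x) \<in> r" by blast
    have "a \<in> Field r" "x \<in> Field r" using insert x by auto
    show ?case
    proof (cases "(a, x) \<in> r")
      case False
      hence "(x, a) \<in> r" using not_underS_iff[OF wo \<open>a \<in> Field r\<close> \<open>x \<in> Field r\<close>]
        by (auto simp: underS_iff)
      hence "\<forall>y\<in>insert a D. (y, a) \<in> r"
        using x Well_order_transD[OF wo] Well_order_reflD[OF wo \<open>a \<in> Field r\<close>] by blast
      thus ?thesis by blast
    qed (use x in blast)
  qed
  thus ?thesis using that by blast
qed

lemma omega_less_total:
  assumes wo: "Well_order r" and f: "f \<in> fin_supp r" and g: "g \<in> fin_supp r"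
  shows "f = g \<or> omega_less r f g \<or> omega_less r g f"
proof (cases "f = g")
  case False
  let ?D = "{x. f x \<noteq> g x}"
  have "?D \<subseteq> {x. f x \<noteq> 0} \<union> {x. g x \<noteq> 0}" by auto
  hence "finite ?D" using f g finite_subset unfolding fin_supp_def by blast
  moreover have "?D \<noteq> {}" using False by auto
  moreover have "?D \<subseteq> Field r" using f g unfolding fin_supp_def by force
  ultimately obtain x where x: "x \<in> ?D" "\<And>y. y \<in> ?D \<Longrightarrow> (y, x) \<in> r"
    using Well_order_greatest_finite[OF wo] by metis
  have eq: "f y = g y" if "x \<in> underS r y" for y
    using x(2)[of y] underS_not_ge[OF wo that] by blast
  have "x \<in> Field r" using x(1) \<open>?D \<subseteq> Field r\<close> by blast
  thus ?thesis using x(1) eq unfolding omega_less_def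
    by (metis (mono_tags, lifting) linorder_neqE_nat mem_Collect_eq)
qed simp

text \<open>Coefficient functions are finite multisets of exponents, and \<open>omega_less\<close>
  is contained in the multiset extension of the well-founded order on exponents.\<close>

lemma wf_omega_less:
  assumes wo: "Well_order r"
  shows "wf {(f, g). f \<in> fin_supp r \<and> g \<in> fin_supp r \<and> omega_less r f g}"
proof -
  let ?R = "\<lambda>a b. a \<in> underS r b"
  have asymp: "asymp ?R" using underS_not_ge[OF wo] by (auto intro!: asympI simp: underS_iff)
  have transp: "transp ?R" using underS_trans'[OF wo] by (rule transpI)
  have "wfp ?R" using Well_order_wf_underS[OF wo] unfolding wfp_def .
  hence "wfp (multp ?R)" by (rule wfp_multp)
  hence wf: "wf {(M, N). multp ?R M N}" unfolding wfp_def .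
  have "multp ?R (Abs_multiset f) (Abs_multiset g)"
    if fg: "f \<in> fin_supp r" "g \<in> fin_supp r" "omega_less r f g" for f g
  proof -
    obtain x where x: "x \<in> Field r" "f x < g x" "\<And>y. y \<in> Field r \<Longrightarrow> x \<in> underS r y \<Longrightarrow> f y = g y"
      using fg(3) unfolding omega_less_def by blast
    have c: "count (Abs_multiset f) = f" "count (Abs_multiset g) = g"
      using fg by (auto simp: fin_supp_def count_Abs_multiset)
    have "multp\<^sub>H\<^sub>O ?R (Abs_multiset f) (Abs_multiset g)"
      unfolding multp\<^sub>H\<^sub>O_def
    proof (intro conjI allI impI)
      show "Abs_multiset f \<noteq> Abs_multiset g" using c x(2) by (metis less_irrefl)
      fix y assume "count (Abs_multiset g) y < count (Abs_multiset f) y"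
      hence gf: "g y < f y" using c by simp
      hence y: "y \<in> Field r" using fg(1) unfolding fin_supp_def by force
      have "y \<in> underS r x"
        using gf x(2) x(3)[OF y] by (cases rule: Well_order_cases[OF wo x(1) y]) auto
      thus "\<exists>x. y \<in> underS r x \<and> count (Abs_multiset f) x < count (Abs_multiset g) x"
        using c x(2) by auto
    qed
    thus ?thesis using multp_eq_multp\<^sub>H\<^sub>O[OF asymp transp] by simp
  qed
  hence "{(f, g). f \<in> fin_supp r \<and> g \<in> fin_supp r \<and> omega_less r f g}
     \<subseteq> inv_image {(M, N). multp ?R M N} Abs_multiset"
    by (auto simp: inv_image_def)
  thus ?thesis by (rule wf_subset[OF wf_inv_image[OF wf]])
qed

lemma Well_order_oexp_omega:
  assumes wo: "Well_order r"
  shows "Well_order (oexp_omega r)"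
proof (rule Well_orderI)
  show "(f, f) \<in> oexp_omega r" if "f \<in> Field (oexp_omega r)" for f
    using that by (simp add: Field_oexp_omega oexp_omega_iff)
  show "(f, h) \<in> oexp_omega r" if "(f, g) \<in> oexp_omega r" "(g, h) \<in> oexp_omega r" for f g h
    using that omega_less_trans[OF wo, of f g h] unfolding oexp_omega_iff by blast
  show "f = g" if "(f, g) \<in> oexp_omega r" "(g, f) \<in> oexp_omega r" for f g
    using that omega_less_trans[OF wo, of f g f] omega_less_irrefl[of r f] unfolding oexp_omega_iff by blast
  show "(f, g) \<in> oexp_omega r \<or> (g, f) \<in> oexp_omega r"
    if "f \<in> Field (oexp_omega r)" "g \<in> Field (oexp_omega r)" for f g
    using that omega_less_total[OF wo, of f g] unfolding Field_oexp_omega oexp_omega_iff by blast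
  have "oexp_omega r - Id \<subseteq> {(f, g). f \<in> fin_supp r \<and> g \<in> fin_supp r \<and> omega_less r f g}"
    by (auto simp: oexp_omega_iff)
  thus "wf (oexp_omega r - Id)" by (rule wf_subset[OF wf_omega_less[OF wo]])
qed

text \<open>The ordinal omega^p as an element of the power.\<close>

definition osingle :: "'b \<Rightarrow> 'b \<Rightarrow> nat" where
  "osingle p = (\<lambda>x. if x = p then 1 else 0)"

text \<open>This is the natural sum, not the ordinal sum: no term is absorbed, so it is strictly
  monotone and cancellative.\<close>

definition oadd :: "('b \<Rightarrow> nat) \<Rightarrow> ('b \<Rightarrow> nat) \<Rightarrow> 'b \<Rightarrow> nat" where
  "oadd f g = (\<lambda>x. f x + g x)"

lemma osingle_fin_supp: "p \<in> Field r \<Longrightarrow> osingle p \<in> fin_supp r"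
  by (auto simp: osingle_def fin_supp_def)

lemma zero_fin_supp: "(\<lambda>_. 0) \<in> fin_supp r"
  by (simp add: fin_supp_def)

lemma oadd_fin_supp: "f \<in> fin_supp r \<Longrightarrow> g \<in> fin_supp r \<Longrightarrow> oadd f g \<in> fin_supp r"
proof -
  assume a: "f \<in> fin_supp r" "g \<in> fin_supp r"
  have "{x. oadd f g x \<noteq> 0} \<subseteq> {x. f x \<noteq> 0} \<union> {x. g x \<noteq> 0}" by (auto simp: oadd_def)
  thus ?thesis using a finite_subset unfolding fin_supp_def by (auto simp: oadd_def)
qed

lemma omega_less_oadd: "omega_less r f g \<Longrightarrow> omega_less r (oadd h f) (oadd h g)"
  unfolding omega_less_def oadd_def by simp

lemma zero_omega_less:
  assumes wo: "Well_order r" and f: "f \<in> fin_supp r" "f \<noteq> (\<lambda>_. 0)"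
  shows "omega_less r (\<lambda>_. 0) f"
  using omega_less_total[OF wo zero_fin_supp f(1)] f(2) by (auto simp: omega_less_def)

lemma omega_less_oadd_self:
  assumes wo: "Well_order r" and f: "f \<in> fin_supp r" "f \<noteq> (\<lambda>_. 0)"
  shows "omega_less r h (oadd h f)"
  using omega_less_oadd[OF zero_omega_less[OF assms], of h] by (simp add: oadd_def)

lemma oexp_omega_oadd_self:
  assumes wo: "Well_order r" and f: "f \<in> fin_supp r" "h \<in> fin_supp r"
  shows "(h, oadd h f) \<in> oexp_omega r"
proof (cases "f = (\<lambda>_. 0)")
  case True thus ?thesis using f by (simp add: oadd_def oexp_omega_iff)
next
  case False
  thus ?thesis using omega_less_oadd_self[OF wo f(1)] oadd_fin_supp f by (auto simp: oexp_omega_iff)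
qed

lemma omega_less_osingle_iff:
  assumes wo: "Well_order r" and p: "p \<in> Field r" and f: "f \<in> fin_supp r"
  shows "omega_less r f (osingle p) \<longleftrightarrow> (\<forall>x. f x \<noteq> 0 \<longrightarrow> x \<in> underS r p)"
proof
  assume "omega_less r f (osingle p)"
  then obtain x where x: "x \<in> Field r" "f x < osingle p x"
    "\<And>y. y \<in> Field r \<Longrightarrow> x \<in> underS r y \<Longrightarrow> f y = osingle p y"
    unfolding omega_less_def by blast
  have xp: "x = p" "f p = 0" using x(2) by (auto simp: osingle_def split: if_splits)
  show "\<forall>x. f x \<noteq> 0 \<longrightarrow> x \<in> underS r p"
  proof (intro allI impI)
    fix y assume y: "f y \<noteq> 0"
    hence yF: "y \<in> Field r" using f by (auto simp: fin_supp_def)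
    show "y \<in> underS r p"
    proof (cases rule: Well_order_cases[OF wo yF p])
      case 1 thus ?thesis using y xp by simp
    next
      case 3
      hence "f y = osingle p y" "y \<noteq> p" using x(3) yF xp by (auto simp: underS_iff)
      thus ?thesis using y by (simp add: osingle_def)
    qed simp
  qed
next
  assume *: "\<forall>x. f x \<noteq> 0 \<longrightarrow> x \<in> underS r p"
  hence "f p < osingle p p" by (auto simp: underS_iff osingle_def)
  moreover have "f y = osingle p y" if "p \<in> underS r y" for y
    using * underS_not_ge[OF wo that] that by (auto simp: underS_iff osingle_def)
  ultimately show "omega_less r f (osingle p)" using p unfolding omega_less_def by blast
qed

text \<open>A form lies below omega^p exactly when all its exponents lie below \<open>p\<close>.
  Hence powers of initial segments are themselves initial segments of one power, as an equality of
  relations and not just up to isomorphism.\<close>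

lemma oexp_omega_Restr:
  assumes wo: "Well_order r" and p: "p \<in> Field r"
  shows "oexp_omega (Restr r (underS r p)) = Restr (oexp_omega r) (underS (oexp_omega r) (osingle p))"
proof -
  let ?s = "Restr r (underS r p)"
  have fs: "f \<in> fin_supp ?s \<longleftrightarrow> f \<in> underS (oexp_omega r) (osingle p)" for f
  proof -
    have "f \<in> fin_supp ?s \<longleftrightarrow> f \<in> fin_supp r \<and> (\<forall>x. f x \<noteq> 0 \<longrightarrow> x \<in> underS r p)"
      unfolding fin_supp_def Field_Restr_underS[OF wo] by (auto dest: underS_in_Field)
    thus ?thesis
      using omega_less_osingle_iff[OF wo p, of f] osingle_fin_supp[OF p] unfolding underS_oexp_omega by blast
  qed
  have ol: "omega_less ?s f g \<longleftrightarrow> omega_less r f g" if "f \<in> fin_supp ?s" "g \<in> fin_supp ?s" for f g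
  proof -
    have out: "f y = 0 \<and> g y = 0" if "y \<notin> underS r p" for y
      using \<open>f \<in> fin_supp ?s\<close> \<open>g \<in> fin_supp ?s\<close> that
      unfolding fin_supp_def Field_Restr_underS[OF wo] by blast
    show ?thesis
    proof
      assume "omega_less ?s f g"
      then obtain x where x: "x \<in> underS r p" "f x < g x"
        "\<And>y. y \<in> underS r p \<Longrightarrow> x \<in> underS ?s y \<Longrightarrow> f y = g y"
        unfolding omega_less_def Field_Restr_underS[OF wo] by blast
      have "f y = g y" if "x \<in> underS r y" for y
        using x(3)[of y] x(1) out[of y] that by (cases "y \<in> underS r p") (auto simp: underS_Restr)
      thus "omega_less r f g" using x(1,2) unfolding omega_less_def by (blast dest: underS_in_Field)
    next
      assume "omega_less r f g"
      then obtain x where x: "x \<in> Field r" "f x < g x"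
        "\<And>y. y \<in> Field r \<Longrightarrow> x \<in> underS r y \<Longrightarrow> f y = g y"
        unfolding omega_less_def by blast
      have "x \<in> underS r p" using x(2) out[of x] by auto
      thus "omega_less ?s f g" using x unfolding omega_less_def Field_Restr_underS[OF wo] underS_Restr
        by (blast dest: underS_in_Field)
    qed
  qed
  have fr: "f \<in> fin_supp r" if "f \<in> fin_supp ?s" for f using that fs underS_oexp_omega by blast
  have "(f, g) \<in> oexp_omega ?s \<longleftrightarrow>
      (f, g) \<in> oexp_omega r \<and> f \<in> fin_supp ?s \<and> g \<in> fin_supp ?s" for f g
    unfolding oexp_omega_iff using ol fr by blast
  thus ?thesis using fs by auto
qed

lemma oexp_omega_mono:
  assumes "r \<le>o r'"
  shows "oexp_omega r \<le>o oexp_omega r'"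
proof -
  have wo: "Well_order r" "Well_order r'" using assms ordLeq_Well_order_simp by blast+
  obtain k where k: "strict_map r r' k" using assms by (rule ordLeq_strict_map)
  have inj: "inj_on k (Field r)"
    using k wo(1) unfolding inj_on_def strict_map_def by (metis Well_order_cases underS_iff)
  have kF: "k x \<in> Field r'" if "x \<in> Field r" for x using k that by (auto simp: strict_map_def)
  define h where "h f = (\<lambda>y. if y \<in> k ` Field r then f (inv_into (Field r) k y) else (0::nat))" for f
  have hk: "h f (k x) = f x" if "x \<in> Field r" for f x
    using that inj by (simp add: h_def)
  have h0: "h f y = 0" if "y \<notin> k ` Field r" for f y using that by (simp add: h_def)
  have hf: "h f \<in> fin_supp r'" if "f \<in> fin_supp r" for f
  proof -
    have "{y. h f y \<noteq> 0} \<subseteq> k ` {x. f x \<noteq> 0}"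
    proof
      fix y assume "y \<in> {y. h f y \<noteq> 0}"
      hence y: "h f y \<noteq> 0" by simp
      hence "y \<in> k ` Field r" using h0[of y f] by linarith
      then obtain x where "x \<in> Field r" "y = k x" "h f y \<noteq> 0" using y by blast
      thus "y \<in> k ` {x. f x \<noteq> 0}" using hk by auto
    qed
    moreover have "finite {x. f x \<noteq> 0}" using that by (simp add: fin_supp_def)
    ultimately have "finite {y. h f y \<noteq> 0}" by (meson finite_imageI finite_subset)
    moreover have "h f y = 0" if "y \<notin> Field r'" for y
      using that kF by (intro h0) blast
    ultimately show ?thesis by (simp add: fin_supp_def)
  qed
  have "strict_map (oexp_omega r) (oexp_omega r') h"
    unfolding strict_map_def Field_oexp_omega underS_oexp_omega
  proof (intro conjI ballI)
    fix g f assume "f \<in> underS (oexp_omega r) g"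
    hence fg: "f \<in> fin_supp r" "g \<in> fin_supp r" "omega_less r f g" by (simp_all add: underS_oexp_omega)
    show "h f \<in> fin_supp r'" "h g \<in> fin_supp r'" using hf fg by auto
    obtain x where x: "x \<in> Field r" "f x < g x" "\<And>y. y \<in> Field r \<Longrightarrow> x \<in> underS r y \<Longrightarrow> f y = g y"
      using fg(3) unfolding omega_less_def by blast
    have "h f (k x) < h g (k x)" using hk x by simp
    moreover have "h f y = h g y" if y: "k x \<in> underS r' y" for y
    proof (cases "y \<in> k ` Field r")
      case True
      then obtain z where z: "z \<in> Field r" "y = k z" by blast
      have "x \<in> underS r z" using strict_map_iff[OF k wo x(1) z(1)] y z by (auto simp: underS_iff)
      thus ?thesis using hk x z by simp
    qed (simp add: h0)
    ultimately show "omega_less r' (h f) (h g)"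
      unfolding omega_less_def using kF[OF x(1)] by (intro bexI[of _ "k x"]) simp_all
  qed (rule hf)
  thus ?thesis
    by (rule strict_map_ordLeq[OF Well_order_oexp_omega[OF wo(1)] Well_order_oexp_omega[OF wo(2)]])
qed

lemma oexp_omega_cong: "r =o r' \<Longrightarrow> oexp_omega r =o oexp_omega r'"
  by (simp add: ordIso_iff_ordLeq oexp_omega_mono)

lemma strict_map_osingle:
  assumes wo: "Well_order r"
  shows "strict_map r (oexp_omega r) osingle"
proof -
  have *: "omega_less r (osingle a) (osingle b)" if ab: "a \<in> underS r b" for a b
  proof -
    have "a \<in> Field r" "b \<in> Field r" using underS_in_Field[OF ab] by auto
    moreover have "x = a" if "osingle a x \<noteq> 0" for x using that by (simp add: osingle_def split: if_splits)
    ultimately show ?thesis using omega_less_osingle_iff[OF wo _ osingle_fin_supp] ab by metis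
  qed
  show "strict_map r (oexp_omega r) osingle"
    unfolding strict_map_def Field_oexp_omega underS_oexp_omega
    by (simp add: * osingle_fin_supp underS_in_Field)
qed

text \<open>Bounds an exponent by its power, so that the exponent of a width can be realised over
  the type of that width.\<close>

lemma ordLeq_oexp_omega: "Well_order r \<Longrightarrow> r \<le>o oexp_omega r"
  using strict_map_ordLeq Well_order_oexp_omega strict_map_osingle by metis

section \<open>Ordinal sums of lists\<close>

lemma Field_osum_list:
  assumes "\<forall>r\<in>set rs. Well_order r"
  shows "Field (osum_list rs) = {(i, x). i < length rs \<and> x \<in> Field (rs ! i)}"
proof -
  have "((i, x), (i, x)) \<in> osum_list rs" if "i < length rs" "x \<in> Field (rs ! i)" for i x
    using that assms Well_order_reflD[of "rs ! i" x] unfolding osum_list_def by simp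
  hence "(i, x) \<in> Field (osum_list rs)" if "i < length rs" "x \<in> Field (rs ! i)" for i x
    using that FieldI1 by fast
  moreover have "fst a < length rs \<and> snd a \<in> Field (rs ! fst a)" if a: "a \<in> Field (osum_list rs)" for a
  proof -
    obtain b where "(a, b) \<in> osum_list rs \<or> (b, a) \<in> osum_list rs"
      using a unfolding Field_def by blast
    thus ?thesis unfolding osum_list_def by auto
  qed
  ultimately show ?thesis by (intro set_eqI) (metis (mono_tags, lifting) case_prodE case_prodI fst_conv mem_Collect_eq snd_conv surj_pair)
qed

lemma underS_osum_list:
  "(i, x) \<in> underS (osum_list rs) (j, y) \<longleftrightarrow> i < length rs \<and> j < length rs \<and>
     x \<in> Field (rs ! i) \<and> y \<in> Field (rs ! j) \<and> (i < j \<or> (i = j \<and> x \<in> underS (rs ! i) y))"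
  unfolding underS_iff osum_list_def by auto

lemma Well_order_osum_list:
  assumes wo: "\<forall>r\<in>set rs. Well_order r"
  shows "Well_order (osum_list rs)"
proof (rule Well_orderI)
  have wo: "Well_order (rs ! i)" if "i < length rs" for i using wo that by simp
  note F = Field_osum_list[OF assms]
  show "(a, a) \<in> osum_list rs" if "a \<in> Field (osum_list rs)" for a
  proof -
    obtain i x where "a = (i, x)" by (metis surj_pair)
    thus ?thesis using that Well_order_reflD[OF wo, of i x] unfolding F by (auto simp: osum_list_def)
  qed
  show "(a, c) \<in> osum_list rs" if ab: "(a, b) \<in> osum_list rs" "(b, c) \<in> osum_list rs" for a b c
  proof -
    obtain i x j y k z where "a = (i, x)" "b = (j, y)" "c = (k, z)" by (metis surj_pair)
    thus ?thesis using ab Well_order_transD[OF wo, of i x y z] by (auto simp: osum_list_def)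
  qed
  show "a = b" if ab: "(a, b) \<in> osum_list rs" "(b, a) \<in> osum_list rs" for a b
  proof -
    obtain i x j y where "a = (i, x)" "b = (j, y)" by (metis surj_pair)
    thus ?thesis using ab Well_order_antisymD[OF wo, of i x y] by (auto simp: osum_list_def)
  qed
  show "(a, b) \<in> osum_list rs \<or> (b, a) \<in> osum_list rs"
    if ab: "a \<in> Field (osum_list rs)" "b \<in> Field (osum_list rs)" for a b
  proof -
    obtain i x j y where [simp]: "a = (i, x)" "b = (j, y)" by (metis surj_pair)
    have i: "i < length rs" "j < length rs" "x \<in> Field (rs ! i)" "y \<in> Field (rs ! j)"
      using ab unfolding F by auto
    show ?thesis
    proof (cases "i = j")
      case True
      thus ?thesis using i not_underS_iff[OF wo, of i x y] by (auto simp: osum_list_def underS_iff)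
    qed (use i in \<open>auto simp: osum_list_def\<close>)
  qed
  show "wf (osum_list rs - Id)"
  proof (rule wfI_min)
    fix a :: "nat \<times> 'a" and Q assume a: "a \<in> Q"
    show "\<exists>z\<in>Q. \<forall>y. (y, z) \<in> osum_list rs - Id \<longrightarrow> y \<notin> Q"
    proof (cases "Q \<subseteq> Field (osum_list rs)")
      case False
      then obtain z where "z \<in> Q" "z \<notin> Field (osum_list rs)" by blast
      thus ?thesis by (auto simp: Field_def)
    next
      case True
      define i where "i = (LEAST i. \<exists>x. (i, x) \<in> Q)"
      have ex: "\<exists>i x. (i, x) \<in> Q" using a by (metis surj_pair)
      have i: "\<exists>x. (i, x) \<in> Q" unfolding i_def using ex by (rule LeastI_ex)
      have le: "i \<le> j" if "(j, x) \<in> Q" for j x unfolding i_def using that by (auto intro: Least_le)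
      have il: "i < length rs" using i True unfolding F by auto
      have "{x. (i, x) \<in> Q} \<subseteq> Field (rs ! i)" using True unfolding F by auto
      then obtain m where m: "m \<in> {x. (i, x) \<in> Q}" "\<forall>x\<in>{x. (i, x) \<in> Q}. (m, x) \<in> rs ! i"
        using i Well_order_least[OF wo[OF il], of "{x. (i, x) \<in> Q}"] by blast
      have "y \<notin> Q" if "(y, (i, m)) \<in> osum_list rs - Id" for y
      proof
        assume y: "y \<in> Q"
        obtain j x where jx: "y = (j, x)" by (metis surj_pair)
        have "y \<in> underS (osum_list rs) (i, m)" using that by (simp add: underS_iff)
        moreover have "i \<le> j" using le y jx by blast
        ultimately have "j = i" "x \<in> underS (rs ! i) m" unfolding jx underS_osum_list by auto
        thus False using m(2) y jx underS_not_ge[OF wo[OF il]] by blast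
      qed
      thus ?thesis using m(1) by blast
    qed
  qed
qed

section \<open>Dickson's lemma\<close>

lemma Well_order_mono_subseq:
  fixes f :: "nat \<Rightarrow> 'c"
  assumes wo: "Well_order r" and f: "\<And>k. f k \<in> Field r"
  obtains \<phi> :: "nat \<Rightarrow> nat" where "strict_mono \<phi>" "\<And>a b. a \<le> b \<Longrightarrow> (f (\<phi> a), f (\<phi> b)) \<in> r"
proof -
  \<comment> \<open>The indices after which no smaller value occurs. Every tail attains its minimum,
    so there are infinitely many of them, and along them \<open>f\<close> is weakly
    increasing.\<close>
  define M where "M = {m. \<forall>k\<ge>m. (f m, f k) \<in> r}"
  have "\<exists>m\<ge>N. m \<in> M" for N
  proof -
    obtain v where v: "v \<in> f ` {N..}" "\<forall>a\<in>f ` {N..}. (v, a) \<in> r"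
      using Well_order_least[OF wo, of "f ` {N..}"] f by blast
    then obtain m where m: "m \<ge> N" "v = f m" by auto
    have "m \<in> M" unfolding M_def using v m by auto
    thus ?thesis using m by blast
  qed
  hence inf: "infinite M" by (simp add: infinite_nat_iff_unbounded_le)
  show ?thesis
  proof (rule that)
    show "strict_mono (enumerate M)" using inf by (rule strict_mono_enumerate)
    show "(f (enumerate M a), f (enumerate M b)) \<in> r" if "a \<le> b" for a b
    proof -
      have "enumerate M a \<in> M" using inf by (rule enumerate_in_set)
      moreover have "enumerate M a \<le> enumerate M b"
        using strict_mono_enumerate[OF inf] that by (simp add: strict_mono_less_eq)
      ultimately show ?thesis unfolding M_def by blast
    qed
  qed
qed

text \<open>Subsequences are thinned out once per coordinate; when all \<open>n\<close> coordinates
  are weakly increasing, the first two terms form a good pair.\<close>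

lemma wqo_prod:
  assumes "\<forall>i<n. Well_order (r i)"
  shows "wqo (prod_le n r) (prod_carrier n r)"
  unfolding wqo_def
proof (intro allI impI)
  fix x :: "nat \<Rightarrow> nat \<Rightarrow> 'a" assume x: "range x \<subseteq> prod_carrier n r"
  have "\<exists>\<phi>::nat \<Rightarrow> nat. strict_mono \<phi> \<and> (\<forall>i<m. \<forall>a b. a \<le> b \<longrightarrow> (x (\<phi> a) i, x (\<phi> b) i) \<in> r i)"
    if "m \<le> n" for m
    using that
  proof (induction m)
    case 0 show ?case by (intro exI[of _ id]) (simp add: strict_mono_def)
  next
    case (Suc m)
    then obtain \<phi> :: "nat \<Rightarrow> nat" where \<phi>: "strict_mono \<phi>"
      "\<And>i a b. i < m \<Longrightarrow> a \<le> b \<Longrightarrow> (x (\<phi> a) i, x (\<phi> b) i) \<in> r i" by auto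
    have "x (\<phi> k) m \<in> Field (r m)" for k
    proof -
      have "x (\<phi> k) \<in> prod_carrier n r" using x by blast
      thus ?thesis using Suc.prems by (simp add: prod_carrier_def)
    qed
    then obtain \<psi> :: "nat \<Rightarrow> nat" where \<psi>: "strict_mono \<psi>"
      "\<And>a b. a \<le> b \<Longrightarrow> (x (\<phi> (\<psi> a)) m, x (\<phi> (\<psi> b)) m) \<in> r m"
      using Well_order_mono_subseq[of "r m" "\<lambda>k. x (\<phi> k) m"] assms Suc.prems by (metis Suc_le_eq)
    have "strict_mono (\<phi> \<circ> \<psi>)" using \<phi>(1) \<psi>(1) by (simp add: strict_mono_def)
    moreover have "(x ((\<phi> \<circ> \<psi>) a) i, x ((\<phi> \<circ> \<psi>) b) i) \<in> r i" if "i < Suc m" "a \<le> b" for i a b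
      using that \<psi> \<phi>(2)[of i "\<psi> a" "\<psi> b"] by (auto simp: less_Suc_eq strict_mono_less_eq)
    ultimately show ?case by blast
  qed
  from this[OF order_refl] obtain \<phi> :: "nat \<Rightarrow> nat" where \<phi>: "strict_mono \<phi>"
    "\<And>i a b. i < n \<Longrightarrow> a \<le> b \<Longrightarrow> (x (\<phi> a) i, x (\<phi> b) i) \<in> r i" by auto
  have "x k \<in> prod_carrier n r" for k using x by blast
  hence "(x (\<phi> 0), x (\<phi> 1)) \<in> prod_le n r" unfolding prod_le_def using \<phi>(2)[of _ 0 1] by simp
  moreover have "\<phi> 0 < \<phi> 1" using \<phi>(1) by (simp add: strict_mono_def)
  ultimately show "\<exists>i j. i < j \<and> (x i, x j) \<in> prod_le n r" by blast
qed

section \<open>Ordinal sums as lower bounds for the width\<close>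

text \<open>An antichain is played from the last zone down to the first one; \<open>C\<close> is chosen only after the
  finite part \<open>F\<close> of the antichain in the later zones is known.\<close>

lemma osum_list_ordLeq_width:
  assumes wqo: "wqo le A" and wo: "\<forall>r\<in>set rs. Well_order r" and BA: "\<And>i. B i \<subseteq> A"
    and ex: "\<And>i F. i < length rs \<Longrightarrow> finite F \<Longrightarrow> F \<subseteq> (\<Union>j\<in>{i<..<length rs}. B j) \<Longrightarrow>
      \<exists>C\<subseteq>B i. (\<forall>y\<in>F. \<forall>c\<in>C. incomp le y c) \<and> rs ! i \<le>o width le C"
  shows "osum_list rs \<le>o width le A"
proof -
  let ?L = "\<lambda>i. \<Union>j\<in>{i<..<length rs}. B j"
  \<comment> \<open>Choosing the answer as a function of the zone and of the set already played
    keeps it fixed while play stays in that zone.\<close>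
  define Ch where "Ch i F = (SOME C. C \<subseteq> B i \<and> (\<forall>y\<in>F. \<forall>c\<in>C. incomp le y c) \<and> rs ! i \<le>o width le C)" for i F
  have Ch: "Ch i F \<subseteq> B i \<and> (\<forall>y\<in>F. \<forall>c\<in>Ch i F. incomp le y c) \<and> rs ! i \<le>o width le (Ch i F)"
    if "i < length rs" "finite F" "F \<subseteq> ?L i" for i F
    unfolding Ch_def using ex[OF that] by (rule someI_ex)
  define K where "K i F = (SOME k. strict_map (rs ! i) (width le (Ch i F)) k)" for i F
  have K: "strict_map (rs ! i) (width le (Ch i F)) (K i F)" if "i < length rs" "finite F" "F \<subseteq> ?L i" for i F
  proof -
    have "rs ! i \<le>o width le (Ch i F)" using Ch[OF that] by simp
    then obtain k where "strict_map (rs ! i) (width le (Ch i F)) k" by (rule ordLeq_strict_map)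
    thus ?thesis unfolding K_def by (rule someI[where P = "strict_map (rs ! i) (width le (Ch i F))"])
  qed
  have wqoC: "wqo le (Ch i F)" if "i < length rs" "finite F" "F \<subseteq> ?L i" for i F
    using Ch[OF that] BA[of i] by (intro wqo_subset[OF wqo]) auto
  \<comment> \<open>Position \<open>xs\<close> with reserve \<open>(i, v)\<close>: the prefix
    \<open>F\<close> was played in later zones, \<open>zs\<close> inside the set answering
    \<open>F\<close> in zone \<open>i\<close>, and the rank of \<open>zs\<close> there is the image
    of \<open>v\<close>.\<close>
  define P where "P xs iv \<longleftrightarrow> (\<exists>F zs. xs = F @ zs \<and> set F \<subseteq> ?L (fst iv) \<and>
      zs \<in> inc_seqs le (Ch (fst iv) (set F)) \<and>
      width_rank le (Ch (fst iv) (set F)) zs = K (fst iv) (set F) (snd iv))" for xs iv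
  have new: "\<exists>zs. zs \<in> inc_seqs le (Ch i (set F)) \<and> width_rank le (Ch i (set F)) zs = K i (set F) v"
    if "i < length rs" "v \<in> Field (rs ! i)" "set F \<subseteq> ?L i" for i v F
  proof -
    have "K i (set F) v \<in> Field (width le (Ch i (set F)))"
      using K[OF that(1) finite_set that(3)] that(2) by (simp add: strict_map_def)
    thus ?thesis unfolding width_rank(2)[OF wqoC[OF that(1) finite_set that(3)], symmetric] by auto
  qed
  have glue: "F @ zs \<in> inc_seqs le A"
    if i: "i < length rs" "set F \<subseteq> ?L i" and F: "set F \<subseteq> A" "sorted_wrt (incomp le) F"
      and zs: "zs \<in> inc_seqs le (Ch i (set F))" for i F zs
    using F zs Ch[OF i(1) finite_set i(2)] BA[of i]
    unfolding inc_seqs_iff sorted_wrt_append set_append by blast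
  show ?thesis
  proof (rule width_lower[OF wqo Well_order_osum_list[OF wo], of P])
    fix iv assume "iv \<in> Field (osum_list rs)"
    then obtain i v where iv: "iv = (i, v)" "i < length rs" "v \<in> Field (rs ! i)"
      unfolding Field_osum_list[OF wo] by blast
    obtain zs where zs: "zs \<in> inc_seqs le (Ch i (set []))" "width_rank le (Ch i (set [])) zs = K i (set []) v"
      using new[OF iv(2,3), of "[]"] by auto
    have "[] @ zs \<in> inc_seqs le A" by (rule glue[OF iv(2) _ _ _ zs(1)]) auto
    moreover have "P ([] @ zs) iv" unfolding P_def iv(1) fst_conv snd_conv
      by (rule exI[of _ "[]"], rule exI[of _ zs]) (use zs in simp)
    ultimately show "\<exists>xs\<in>inc_seqs le A. P xs iv" by blast
  next
    fix xs jw iv assume xs: "xs \<in> inc_seqs le A" and P: "P xs iv" and lt: "jw \<in> underS (osum_list rs) iv"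
    obtain i v j w where ij: "iv = (i, v)" "jw = (j, w)" by (metis surj_pair)
    obtain F zs where F: "xs = F @ zs" "set F \<subseteq> ?L i" "zs \<in> inc_seqs le (Ch i (set F))"
      "width_rank le (Ch i (set F)) zs = K i (set F) v"
      using P unfolding P_def ij fst_conv snd_conv by blast
    have l: "j < length rs" "i < length rs" "w \<in> Field (rs ! j)" "v \<in> Field (rs ! i)"
      and lt': "j < i \<or> (j = i \<and> w \<in> underS (rs ! i) v)"
      using lt unfolding ij underS_osum_list by auto
    have xsA: "set xs \<subseteq> A" "sorted_wrt (incomp le) xs" using xs by (auto simp: inc_seqs_iff)
    from lt' show "\<exists>zs. zs \<noteq> [] \<and> xs @ zs \<in> inc_seqs le A \<and> P (xs @ zs) jw"
    proof
      assume ji: "j < i"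
      have "set zs \<subseteq> B i" using F(3) Ch[OF l(2) finite_set F(2)] unfolding inc_seqs_iff by blast
      hence sx: "set xs \<subseteq> ?L j" using F(1,2) ji l(2) by fastforce
      obtain ws where ws: "ws \<in> inc_seqs le (Ch j (set xs))"
        "width_rank le (Ch j (set xs)) ws = K j (set xs) w"
        using new[OF l(1,3) sx] by blast
      have "xs @ ws \<in> inc_seqs le A" by (rule glue[OF l(1) sx xsA ws(1)])
      moreover have "P (xs @ ws) jw" unfolding P_def ij fst_conv snd_conv using ws sx by blast
      moreover have "ws \<noteq> []" using ws(1) by (simp add: inc_seqs_iff)
      ultimately show ?thesis by blast
    next
      \<comment> \<open>Within a zone the prefix \<open>F\<close> is unchanged, hence so are
        \<open>Ch\<close> and \<open>K\<close>; the smaller reserve has a smaller image and is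
        reached by prolonging \<open>zs\<close>.\<close>
      assume "j = i \<and> w \<in> underS (rs ! i) v"
      hence ji: "j = i" and w: "w \<in> underS (rs ! i) v" by auto
      have "K i (set F) w \<in> underS (width le (Ch i (set F))) (K i (set F) v)"
        using K[OF l(2) finite_set F(2)] w l(4) by (simp add: strict_map_def)
      then obtain ws where ws: "ws \<noteq> []" "zs @ ws \<in> inc_seqs le (Ch i (set F))"
        "width_rank le (Ch i (set F)) (zs @ ws) = K i (set F) w"
        using width_rank(4)[OF wqoC[OF l(2) finite_set F(2)] F(3), of "K i (set F) w"] F(4) by metis
      have "F @ (zs @ ws) \<in> inc_seqs le A"
        using xsA F(1) by (intro glue[OF l(2) F(2) _ _ ws(2)]) (auto simp: sorted_wrt_append)
      moreover have "P (F @ (zs @ ws)) jw"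
        unfolding P_def ij ji fst_conv snd_conv using ws F(2) by blast
      ultimately show ?thesis using ws(1) F(1) by (intro exI[of _ ws]) simp
    qed
  qed
qed

section \<open>Products of powers of omega\<close>

definition prod_map :: "nat \<Rightarrow> (nat \<Rightarrow> 'c \<Rightarrow> 'd) \<Rightarrow> (nat \<Rightarrow> 'c) \<Rightarrow> nat \<Rightarrow> 'd" where
  "prod_map n f z = (\<lambda>i. if i < n then f i (z i) else undefined)"

lemma prod_map_carrier:
  "\<forall>i<n. strict_map (r i) (r' i) (f i) \<Longrightarrow> z \<in> prod_carrier n r \<Longrightarrow> prod_map n f z \<in> prod_carrier n r'"
  by (simp add: prod_map_def prod_carrier_def strict_map_def)

lemma incomp_prod_iff:
  "x \<in> prod_carrier n r \<Longrightarrow> y \<in> prod_carrier n r \<Longrightarrow>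
    incomp (prod_le n r) x y \<longleftrightarrow> (\<exists>i<n. (x i, y i) \<notin> r i) \<and> (\<exists>i<n. (y i, x i) \<notin> r i)"
  by (auto simp: incomp_def prod_le_def)

text \<open>A strict map between well-orders also reflects the order, so applying one in each
  coordinate preserves comparability and incomparability alike.\<close>

lemma prod_map_incomp:
  assumes f: "\<forall>i<n. strict_map (r i) (r' i) (f i)" and wo: "\<forall>i<n. Well_order (r i)" "\<forall>i<n. Well_order (r' i)"
    and z: "z \<in> prod_carrier n r" "z' \<in> prod_carrier n r"
  shows "incomp (prod_le n r') (prod_map n f z) (prod_map n f z') \<longleftrightarrow> incomp (prod_le n r) z z'"
proof -
  have "(f i (z i), f i (z' i)) \<in> r' i \<longleftrightarrow> (z i, z' i) \<in> r i"
    "(f i (z' i), f i (z i)) \<in> r' i \<longleftrightarrow> (z' i, z i) \<in> r i" if "i < n" for i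
    using strict_map_iff[of "r i" "r' i" "f i"] f wo z that by (auto simp: prod_carrier_def)
  thus ?thesis
    unfolding incomp_prod_iff[OF z] incomp_prod_iff[OF prod_map_carrier[OF f z(1)] prod_map_carrier[OF f z(2)]]
    by (auto simp: prod_map_def)
qed

lemma strict_map_oadd:
  "Well_order r \<Longrightarrow> h \<in> fin_supp r \<Longrightarrow> strict_map (oexp_omega r) (oexp_omega r) (oadd h)"
  by (simp add: strict_map_def underS_oexp_omega Field_oexp_omega oadd_fin_supp omega_less_oadd)

text \<open>Elements below \<open>x\<close> stay in place and all others move up by
  \<open>h\<close>. Order survives at the border because nothing moves down: \<open>v\<close> is at
  most \<open>oadd h v\<close>.\<close>

lemma strict_map_oadd_above:
  assumes wo: "Well_order r" and h: "h \<in> fin_supp r" and x: "x \<in> fin_supp r"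
  shows "strict_map (oexp_omega r) (oexp_omega r) (\<lambda>u. if u \<in> underS (oexp_omega r) x then u else oadd h u)"
  unfolding strict_map_def
proof (intro conjI ballI)
  note woO = Well_order_oexp_omega[OF wo]
  fix v assume v: "v \<in> Field (oexp_omega r)"
  let ?f = "\<lambda>u. if u \<in> underS (oexp_omega r) x then u else oadd h u"
  show "?f v \<in> Field (oexp_omega r)" using v oadd_fin_supp[OF h] by (simp add: Field_oexp_omega)
  fix u assume u: "u \<in> underS (oexp_omega r) v"
  have comm: "oadd h v = oadd v h" by (auto simp: oadd_def)
  have v': "v \<in> fin_supp r" using v by (simp add: Field_oexp_omega)
  have le: "(v, oadd h v) \<in> oexp_omega r" unfolding comm by (rule oexp_omega_oadd_self[OF wo h v'])
  show "?f u \<in> underS (oexp_omega r) (?f v)"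
  proof (cases "v \<in> underS (oexp_omega r) x")
    case True
    thus ?thesis using u underS_trans'[OF woO u True] by simp
  next
    case vx: False
    show ?thesis
    proof (cases "u \<in> underS (oexp_omega r) x")
      case True thus ?thesis using vx underS_le_trans[OF woO u le] by simp
    next
      case False
      have "oadd h u \<in> underS (oexp_omega r) (oadd h v)"
        using strict_map_oadd[OF wo h] u v by (simp add: strict_map_def)
      thus ?thesis using vx False by simp
    qed
  qed
qed

lemma finite_subset_bounded:
  assumes wo: "Well_order r" and "Field r \<noteq> {}" "finite D" "D \<subseteq> Field r"
  obtains m where "m \<in> Field r" "\<And>d. d \<in> D \<Longrightarrow> (d, m) \<in> r"
proof (cases "D = {}")
  case True
  obtain m where "m \<in> Field r" using assms(2) by auto
  thus ?thesis using that[of m] True by simp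
next
  case False
  obtain x where "x \<in> D" "\<And>y. y \<in> D \<Longrightarrow> (y, x) \<in> r"
    using Well_order_greatest_finite[OF wo assms(3) False assms(4)] by metis
  thus ?thesis using that[of x] assms(4) by auto
qed

lemma prod_finite_bounded:
  assumes wo: "\<forall>i<n. Well_order (e i)" and F: "finite F" "F \<subseteq> prod_carrier n (\<lambda>i. oexp_omega (e i))"
  obtains M where "\<And>i. i < n \<Longrightarrow> M i \<in> fin_supp (e i)"
    "\<And>i y. i < n \<Longrightarrow> y \<in> F \<Longrightarrow> (y i, M i) \<in> oexp_omega (e i)"
proof -
  have "\<exists>m. m \<in> fin_supp (e i) \<and> (\<forall>y\<in>F. (y i, m) \<in> oexp_omega (e i))" if "i < n" for i
  proof -
    have "(\<lambda>y. y i) ` F \<subseteq> Field (oexp_omega (e i))" using F(2) that by (auto simp: prod_carrier_def)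
    moreover have "Well_order (oexp_omega (e i))" using wo that Well_order_oexp_omega by blast
    moreover have "Field (oexp_omega (e i)) \<noteq> {}" using zero_fin_supp[of "e i"] by (auto simp: Field_oexp_omega)
    ultimately obtain m where "m \<in> Field (oexp_omega (e i))" "\<And>d. d \<in> (\<lambda>y. y i) ` F \<Longrightarrow> (d, m) \<in> oexp_omega (e i)"
      using finite_subset_bounded[of "oexp_omega (e i)" "(\<lambda>y. y i) ` F"] F(1) by blast
    thus ?thesis by (auto simp: Field_oexp_omega)
  qed
  then obtain M where "\<forall>i<n. M i \<in> fin_supp (e i) \<and> (\<forall>y\<in>F. (y i, M i) \<in> oexp_omega (e i))" by metis
  thus ?thesis using that by blast
qed

text \<open>First play \<open>x + x\<close>, then a copy of the residual of \<open>x\<close> shifted above \<open>x\<close>; if \<open>M\<close> bounds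
  everything played so far, a second copy of the residual is obtained by moving the coordinates that
  are not below \<open>x\<close> beyond \<open>M\<close>.\<close>

lemma width_prod_double:
  fixes e :: "nat \<Rightarrow> 'b rel" and n :: nat
  defines "r \<equiv> \<lambda>i. oexp_omega (e i)"
  defines "X \<equiv> prod_carrier n r" and "le \<equiv> prod_le n r"
  assumes wo: "\<forall>i<n. Well_order (e i)" and x: "x \<in> X"
  shows "\<exists>y0\<in>X. osum_list [width le {y \<in> X. incomp le x y}, width le {y \<in> X. incomp le x y}, width le {y0}]
    \<le>o width le X"
proof -
  let ?C = "{y \<in> X. incomp le x y}"
  have wor: "\<forall>i<n. Well_order (r i)" using wo Well_order_oexp_omega unfolding r_def by blast
  have wqo: "wqo le X" unfolding le_def X_def by (rule wqo_prod[OF wor])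
  have X_nth: "z i \<in> fin_supp (e i)" if "z \<in> X" "i < n" for z i
    using that by (auto simp: X_def r_def prod_carrier_def Field_oexp_omega)
  define sh where "sh = prod_map n (\<lambda>i. oadd (x i))"
  have shm: "\<forall>i<n. strict_map (r i) (r i) (oadd (x i))"
    unfolding r_def using strict_map_oadd wo X_nth[OF x] by blast
  have shX: "sh z \<in> X" if "z \<in> X" for z
    using prod_map_carrier[OF shm] that unfolding sh_def X_def by blast
  have sh_inc: "incomp le (sh z) (sh z') \<longleftrightarrow> incomp le z z'" if "z \<in> X" "z' \<in> X" for z z'
    using prod_map_incomp[OF shm wor wor] that unfolding sh_def le_def X_def by blast
  have sh_ge: "(x i, sh z i) \<in> r i" if "z \<in> X" "i < n" for z i
    using oexp_omega_oadd_self[of "e i" "z i" "x i"] X_nth x that wo by (simp add: sh_def prod_map_def r_def)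
  \<comment> \<open>Zones are numbered against the order of play: the single point
    \<open>sh x\<close>, that is \<open>x + x\<close>, comes first, then the shifted residual in
    zone 1, then the second copy in zone 0. The extra point makes the resulting inequality
    strict.\<close>
  define B where "B i = (if i = 0 then X else if i = (1::nat) then sh ` ?C else {sh x})" for i
  let ?rs = "[width le ?C, width le ?C, width le {sh x}]"
  have "osum_list ?rs \<le>o width le X"
  proof (rule osum_list_ordLeq_width[OF wqo, of _ B])
    show "B i \<subseteq> X" for i using shX x by (auto simp: B_def)
    have "wqo le ?C" "wqo le {sh x}" using wqo_subset[OF wqo] shX[OF x] by auto
    thus "\<forall>r\<in>set ?rs. Well_order r" using width_rank(1) by auto
    fix i F assume i: "i < length ?rs" and F: "finite F" "F \<subseteq> (\<Union>j\<in>{i<..<length ?rs}. B j)"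
    consider "i = 0" | "i = 1" | "i = 2" using i by force
    thus "\<exists>C\<subseteq>B i. (\<forall>y\<in>F. \<forall>c\<in>C. incomp le y c) \<and> ?rs ! i \<le>o width le C"
    proof cases
      case 1
      have "F \<subseteq> sh ` insert x ?C"
      proof
        fix y assume "y \<in> F"
        hence "y \<in> (\<Union>j\<in>{i<..<length ?rs}. B j)" using F(2) by (rule subsetD[rotated])
        then obtain j where "j \<in> {i<..<length ?rs}" "y \<in> B j" by (rule UN_E)
        thus "y \<in> sh ` insert x ?C" by (auto simp: B_def split: if_splits)
      qed
      hence F': "F \<subseteq> sh ` X" using x by blast
      hence FX: "F \<subseteq> X" using shX by blast
      obtain M where M: "\<And>i. i < n \<Longrightarrow> M i \<in> fin_supp (e i)"
        "\<And>i y. i < n \<Longrightarrow> y \<in> F \<Longrightarrow> (y i, M i) \<in> r i"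
        using prod_finite_bounded[OF wo F(1)] FX unfolding X_def r_def by blast
      define f where "f i = (\<lambda>u. if u \<in> underS (r i) (x i) then u else oadd (M i) u)" for i
      have fm: "\<forall>i<n. strict_map (r i) (r i) (f i)"
        unfolding r_def f_def using strict_map_oadd_above wo M(1) X_nth[OF x] by blast
      let ?\<phi> = "prod_map n f"
      have \<phi>X: "?\<phi> z \<in> X" if "z \<in> X" for z using prod_map_carrier[OF fm] that unfolding X_def by blast
      have \<phi>_inc: "incomp le (?\<phi> z) (?\<phi> z') \<longleftrightarrow> incomp le z z'" if "z \<in> X" "z' \<in> X" for z z'
        using prod_map_incomp[OF fm wor wor] that unfolding le_def X_def by blast
      have "incomp le y (?\<phi> z)" if y: "y \<in> F" and z: "z \<in> ?C" for y z
      proof -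
        have zX: "z \<in> X" and zi: "incomp le x z" using z by auto
        obtain i j where ij: "i < n" "(x i, z i) \<notin> r i" "j < n" "(z j, x j) \<notin> r j"
          using zi x zX incomp_prod_iff unfolding le_def X_def by blast
        have fld: "z i \<in> Field (r i)" "x i \<in> Field (r i)" "z j \<in> Field (r j)" "x j \<in> Field (r j)"
          using zX x ij by (auto simp: X_def prod_carrier_def)
        have zx: "z i \<in> underS (r i) (x i)" using not_underS_iff[of "r i"] wor ij fld by blast
        have xz: "x j \<in> underS (r j) (z j)" using not_underS_iff[of "r j"] wor ij fld by blast
        obtain w where w: "w \<in> X" "y = sh w" using y F' by blast
        have "z i \<in> underS (r i) (y i)" using underS_le_trans[of "r i"] zx sh_ge[OF w(1) ij(1)] w wor ij by blast
        hence "(y i, ?\<phi> z i) \<notin> r i"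
          using underS_not_ge[of "r i"] wor ij zx by (simp add: prod_map_def f_def)
        moreover have "(?\<phi> z j, y j) \<notin> r j"
        proof -
          have woj: "Well_order (e j)" using wo ij by blast
          \<comment> \<open>Lying above \<open>x j\<close>, the summand \<open>z j\<close> is
            nonzero, so adding it to \<open>M j\<close> goes strictly beyond
            \<open>M j\<close>.\<close>
          have "z j \<noteq> (\<lambda>_. 0)" using xz unfolding r_def underS_oexp_omega by (auto simp: omega_less_def)
          hence "omega_less (e j) (M j) (oadd (M j) (z j))"
            using omega_less_oadd_self[OF woj] X_nth zX ij by blast
          hence "M j \<in> underS (r j) (oadd (M j) (z j))"
            using M(1) oadd_fin_supp X_nth zX ij unfolding r_def underS_oexp_omega by blast
          moreover have "z j \<notin> underS (r j) (x j)" using underS_not_ge[of "r j"] xz wor ij by (auto simp: underS_iff)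
          ultimately have "M j \<in> underS (r j) (?\<phi> z j)" using ij by (simp add: prod_map_def f_def)
          hence "y j \<in> underS (r j) (?\<phi> z j)" using le_underS_trans[of "r j"] M(2)[OF ij(3) y] wor ij by blast
          thus ?thesis using underS_not_ge[of "r j"] wor ij by blast
        qed
        ultimately show ?thesis
          using incomp_prod_iff[of y n r "?\<phi> z"] FX y \<phi>X[OF zX] ij unfolding le_def X_def by blast
      qed
      moreover have "width le ?C \<le>o width le (?\<phi> ` ?C)"
      proof (rule width_mono)
        show "wqo le ?C" using wqo_subset[OF wqo] by auto
        show "wqo le (?\<phi> ` ?C)" using \<phi>X by (intro wqo_subset[OF wqo]) auto
        show "?\<phi> ` ?C \<subseteq> ?\<phi> ` ?C" by simp
        show "incomp le (?\<phi> z) (?\<phi> z')" if "z \<in> ?C" "z' \<in> ?C" "incomp le z z'" for z z'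
          using that \<phi>_inc by auto
      qed
      moreover have "?\<phi> ` ?C \<subseteq> B i" using \<phi>X 1 by (auto simp: B_def)
      ultimately show ?thesis using 1 by (intro exI[of _ "?\<phi> ` ?C"]) auto
    next
      case 2
      have "F \<subseteq> {sh x}"
      proof
        fix y assume "y \<in> F"
        hence "y \<in> (\<Union>j\<in>{i<..<length ?rs}. B j)" using F(2) by (rule subsetD[rotated])
        then obtain j where "j \<in> {i<..<length ?rs}" "y \<in> B j" by (rule UN_E)
        thus "y \<in> {sh x}" using 2 by (auto simp: B_def split: if_splits)
      qed
      hence "incomp le y c" if "y \<in> F" "c \<in> sh ` ?C" for y c using that sh_inc x by auto
      moreover have "width le ?C \<le>o width le (sh ` ?C)"
      proof (rule width_mono)
        show "wqo le ?C" using wqo_subset[OF wqo] by auto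
        show "wqo le (sh ` ?C)" using shX by (intro wqo_subset[OF wqo]) auto
        show "sh ` ?C \<subseteq> sh ` ?C" by simp
        show "incomp le (sh z) (sh z')" if "z \<in> ?C" "z' \<in> ?C" "incomp le z z'" for z z'
          using that sh_inc by auto
      qed
      ultimately show ?thesis using 2 by (intro exI[of _ "sh ` ?C"]) (auto simp: B_def)
    next
      case 3
      hence "{i<..<length ?rs} = {}" by auto
      hence "F = {}" using F(2) by simp
      moreover have "width le {sh x} \<le>o width le {sh x}"
        by (rule ordLeq_reflexive[OF width_rank(1)[OF wqo_subset[OF wqo]]]) (use shX[OF x] in simp)
      ultimately show ?thesis using 3 by (intro exI[of _ "{sh x}"]) (auto simp: B_def)
    qed
  qed
  thus ?thesis using shX[OF x] by blast
qed

section \<open>Additively indecomposable widths are powers of omega\<close>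

lemma width_nonempty:
  assumes "wqo le A" "x \<in> A"
  shows "Field (width le A) \<noteq> {}"
proof -
  have "[x] \<in> inc_seqs le A" using assms(2) by (simp add: inc_seqs_iff)
  thus ?thesis unfolding width_rank(2)[OF assms(1), symmetric] by blast
qed

text \<open>The multiple omega^p n, used to measure the leading coefficient of an ordinal.\<close>

definition omul :: "nat \<Rightarrow> 'b \<Rightarrow> 'b \<Rightarrow> nat" where
  "omul n p = (\<lambda>x. if x = p then n else 0)"

lemma omul_fin_supp: "p \<in> Field r \<Longrightarrow> omul n p \<in> fin_supp r"
  by (auto simp: omul_def fin_supp_def)

lemma omega_less_omul_iff:
  assumes wo: "Well_order r" and p: "p \<in> Field r" and f: "f \<in> fin_supp r"
  shows "omega_less r f (omul n p) \<longleftrightarrow> f p < n \<and> (\<forall>y. p \<in> underS r y \<longrightarrow> f y = 0)"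
proof
  assume "omega_less r f (omul n p)"
  then obtain x where x: "x \<in> Field r" "f x < omul n p x"
    "\<And>y. y \<in> Field r \<Longrightarrow> x \<in> underS r y \<Longrightarrow> f y = omul n p y"
    unfolding omega_less_def by blast
  have xp: "x = p" "f p < n" using x(2) by (auto simp: omul_def split: if_splits)
  moreover have "f y = 0" if "p \<in> underS r y" for y
    using x(3)[of y] that xp underS_in_Field[OF that] by (auto simp: omul_def underS_iff)
  ultimately show "f p < n \<and> (\<forall>y. p \<in> underS r y \<longrightarrow> f y = 0)" by blast
next
  assume *: "f p < n \<and> (\<forall>y. p \<in> underS r y \<longrightarrow> f y = 0)"
  hence "f p < omul n p p" by (simp add: omul_def)
  moreover have "f y = omul n p y" if "p \<in> underS r y" for y
    using * that by (auto simp: underS_iff omul_def)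
  ultimately show "omega_less r f (omul n p)" using p unfolding omega_less_def by blast
qed

lemma ordLess_Restr_underS:
  assumes wo: "Well_order r" and "a \<in> underS r b"
  shows "Restr r (underS r a) <o Restr r (underS r b)"
  using Restr_underS_ordLeq_iff[OF wo, of b a] underS_not_ge[OF assms] underS_in_Field[OF assms(2)]
    not_ordLeq_iff_ordLess[OF Well_order_Restr[OF wo] Well_order_Restr[OF wo]] by blast

text \<open>Represent \<open>g\<close> as the segment below a normal form \<open>F\<close> with
  leading exponent \<open>p\<close>. If \<open>F\<close> were not omega^p itself, then omega^p would
  be below \<open>F\<close>, and by \<open>dbl\<close> so would be all its finite multiples; but
  \<open>F\<close> is below the multiple by \<open>Suc (F p)\<close>. The nonempty third summand
  \<open>b\<close> makes the doubling strict.\<close>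

lemma indecomposable_oexp_omega:
  fixes g :: "'u rel"
  assumes wog: "Well_order g" and ne: "Field g \<noteq> {}"
    and dbl: "\<And>\<gamma>. \<gamma> \<in> Field g \<Longrightarrow> \<exists>(a::'u rel) b. Well_order a \<and> Well_order b \<and> Field b \<noteq> {} \<and>
      Restr g (underS g \<gamma>) \<le>o a \<and> osum_list [a, a, b] \<le>o g"
  obtains e :: "'u rel" where "Well_order e" "g =o oexp_omega e"
proof -
  obtain W :: "'u set rel" where W: "Well_order W" "Field W = UNIV" by (rule ex_Well_order_UNIV)
  let ?O = "oexp_omega W"
  have woO: "Well_order ?O" using Well_order_oexp_omega[OF W(1)] .
  have "g <o ?O"
    using ordLess_Well_order_UNIV_set[OF wog W] ordLeq_oexp_omega[OF W(1)] ordLess_ordLeq_trans by blast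
  then obtain F where F: "F \<in> fin_supp W" "g =o Restr ?O (underS ?O F)"
    using ordLess_iff_ordIso_Restr[OF woO wog] unfolding Field_oexp_omega by blast
  have "F \<noteq> (\<lambda>_. 0)"
  proof
    assume "F = (\<lambda>_. 0)"
    hence "underS ?O F = {}" by (auto simp: underS_oexp_omega omega_less_def)
    moreover obtain h where "strict_map g (Restr ?O (underS ?O F)) h"
      using F(2) ordIso_imp_ordLeq ordLeq_strict_map by blast
    ultimately show False using ne by (auto simp: strict_map_def)
  qed
  hence "{x. F x \<noteq> 0} \<noteq> {}" by auto
  then obtain p where p: "F p \<noteq> 0" "\<And>y. F y \<noteq> 0 \<Longrightarrow> (y, p) \<in> W"
    using Well_order_greatest_finite[OF W(1), of "{x. F x \<noteq> 0}"] F(1) W(2)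
    unfolding fin_supp_def by auto
  have pF: "p \<in> Field W" using W by simp
  have Fp: "F y = 0" if "p \<in> underS W y" for y using p(2) underS_not_ge[OF W(1) that] by blast
  have mul1: "omul 1 p = osingle p" by (rule ext) (simp add: omul_def osingle_def)
  \<comment> \<open>If \<open>F\<close> were at most omega^p (n+1), doubling the segment below
    omega^p n and adding a point would put omega^p n + omega^p n + 1 into \<open>g\<close>. As
    \<open>n\<close> is positive, that exceeds omega^p (n+1), hence \<open>F\<close>.\<close>
  have step: "omega_less W (omul (Suc n) p) F" if n: "omega_less W (omul n p) F" and npos: "0 < n" for n
  proof (rule ccontr)
    let ?G = "omul (Suc n) p"
    assume "\<not> omega_less W ?G F"
    hence FG: "(F, ?G) \<in> ?O"
      using omega_less_total[OF W(1) omul_fin_supp[OF pF] F(1)] F(1) omul_fin_supp[OF pF]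
      unfolding oexp_omega_iff by metis
    have "omul n p \<in> underS ?O F" using n F(1) omul_fin_supp[OF pF] by (simp add: underS_oexp_omega)
    hence "Restr ?O (underS ?O (omul n p)) <o g"
      using ordLess_Restr_underS[OF woO] F(2) ordIso_symmetric ordLess_ordIso_trans by blast
    then obtain \<gamma> where \<gamma>: "\<gamma> \<in> Field g" "Restr ?O (underS ?O (omul n p)) =o Restr g (underS g \<gamma>)"
      using ordLess_iff_ordIso_Restr[OF wog Well_order_Restr[OF woO]] by blast
    then obtain a b :: "'u rel" where ab: "Well_order a" "Well_order b" "Field b \<noteq> {}"
      "Restr g (underS g \<gamma>) \<le>o a" "osum_list [a, a, b] \<le>o g" using dbl by blast
    obtain b0 where b0: "b0 \<in> Field b" using ab(3) by blast
    obtain k where k: "strict_map (Restr ?O (underS ?O (omul n p))) a k"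
      using ordIso_ordLeq_trans[OF \<gamma>(2) ab(4)] by (rule ordLeq_strict_map)
    have uS: "f \<in> underS ?O (omul n p)" if "f \<in> fin_supp W" "omega_less W f (omul n p)" for f
      using that omul_fin_supp[OF pF] by (simp add: underS_oexp_omega)
    have kF: "k f \<in> Field a" if "f \<in> fin_supp W" "omega_less W f (omul n p)" for f
      using k uS[OF that] by (simp add: strict_map_def Field_Restr_underS[OF woO])
    have k_less: "k f \<in> underS a (k f')"
      if "f \<in> fin_supp W" "omega_less W f (omul n p)" "f' \<in> fin_supp W" "omega_less W f' (omul n p)" "omega_less W f f'" for f f'
    proof -
      have "f \<in> underS ?O f'" using that by (simp add: underS_oexp_omega)
      thus ?thesis using k uS[OF that(1,2)] uS[OF that(3,4)]
        by (simp add: strict_map_def Field_Restr_underS[OF woO] underS_Restr)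
    qed
    \<comment> \<open>The closed segment, with \<open>?G\<close> included: its order type is omega^p
      (n+1) + 1, and the final 1 gives the contradiction.\<close>
    let ?U = "Restr ?O (under ?O ?G)"
    have FU: "Field ?U = under ?O ?G"
      by (rule Refl_Field_Restr2) (use wo_rel.REFL[of ?O] woO in \<open>auto simp: wo_rel_def under_def Field_def\<close>)
    have U: "f \<in> fin_supp W" "f p \<le> Suc n" "\<And>y. p \<in> underS W y \<Longrightarrow> f y = 0" "f p = Suc n \<Longrightarrow> f = ?G"
      if "f \<in> under ?O ?G" for f
    proof -
      have f: "f \<in> fin_supp W" "f = ?G \<or> omega_less W f ?G" using that by (auto simp: under_def oexp_omega_iff)
      show "f \<in> fin_supp W" using f by simp
      have G: "?G p = Suc n" "\<And>y. p \<in> underS W y \<Longrightarrow> ?G y = 0" by (auto simp: omul_def underS_iff)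
      show "f p \<le> Suc n" "f p = Suc n \<Longrightarrow> f = ?G"
        using f(2) omega_less_omul_iff[OF W(1) pF f(1)] G(1) by auto
      show "f y = 0" if "p \<in> underS W y" for y
        using f(2) omega_less_omul_iff[OF W(1) pF f(1)] G(2)[OF that] that by blast
    qed
    have red: "f(p := 0) \<in> fin_supp W" if "f \<in> fin_supp W" for f
    proof -
      have "{x. (f(p := 0)) x \<noteq> 0} \<subseteq> {x. f x \<noteq> 0}" by auto
      moreover have "finite {x. f x \<noteq> 0}" using that by (simp add: fin_supp_def)
      ultimately have "finite {x. (f(p := 0)) x \<noteq> 0}" by (rule finite_subset)
      thus ?thesis using W(2) by (simp only: fin_supp_def mem_Collect_eq UNIV_I not_True_eq_False simp_thms)
    qed
    \<comment> \<open>The leading coefficient selects the summand: below \<open>n\<close> the first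
      copy of \<open>a\<close>, equal to \<open>n\<close> the second copy with the leading term
      removed, and \<open>Suc n\<close> only for \<open>?G\<close> itself, which goes to the extra
      point \<open>b0\<close>.\<close>
    define h where "h f = (if f p < n then (0::nat, k f) else if f p = n then (1, k (f(p := 0))) else (2, b0))" for f
    have c0: "omega_less W f (omul n p)" if "f \<in> under ?O ?G" "f p < n" for f
      using omega_less_omul_iff[OF W(1) pF U(1)[OF that(1)]] U(3)[OF that(1)] that(2) by blast
    have c1: "omega_less W (f(p := 0)) (omul n p)" if "f \<in> under ?O ?G" for f
      using omega_less_omul_iff[OF W(1) pF red[OF U(1)[OF that]]] U(3)[OF that] npos by (auto simp: underS_iff)
    have lessD: "f p < f' p \<or> (f p = f' p \<and> omega_less W (f(p := 0)) (f'(p := 0)))"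
      if f: "f \<in> under ?O ?G" "f' \<in> under ?O ?G" "omega_less W f f'" for f f'
    proof -
      obtain x where x: "x \<in> Field W" "f x < f' x" "\<And>y. y \<in> Field W \<Longrightarrow> x \<in> underS W y \<Longrightarrow> f y = f' y"
        using f(3) unfolding omega_less_def by blast
      show ?thesis
      proof (cases rule: Well_order_cases[OF W(1) x(1) pF])
        case 1 thus ?thesis using x by simp
      next
        case 2
        hence xp: "x \<noteq> p" by (simp add: underS_iff)
        have "omega_less W (f(p := 0)) (f'(p := 0))"
          unfolding omega_less_def using x xp by (intro bexI[of _ x]) auto
        thus ?thesis using x(3)[OF pF 2] by simp
      next
        case 3 thus ?thesis using x(2) U(3)[OF f(2) 3] by simp
      qed
    qed
    have "strict_map ?U (osum_list [a, a, b]) h"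
      unfolding strict_map_def FU
    proof (intro conjI ballI)
      have woab: "\<forall>r\<in>set [a, a, b]. Well_order r" using ab by simp
      fix f' assume f': "f' \<in> under ?O ?G"
      show "h f' \<in> Field (osum_list [a, a, b])"
        unfolding Field_osum_list[OF woab] h_def
        using kF[OF U(1)[OF f'] c0[OF f']] kF[OF red[OF U(1)[OF f']] c1[OF f']] b0 by auto
      fix f assume "f \<in> underS ?U f'"
      hence f: "f \<in> under ?O ?G" "omega_less W f f'" by (auto simp: underS_Restr underS_oexp_omega)
      have kk: "k f \<in> underS a (k f')" if "f p < n" "f' p < n"
        using k_less[OF U(1)[OF f(1)] c0[OF f(1) that(1)] U(1)[OF f'] c0[OF f' that(2)] f(2)] .
      have kk': "k (f(p := 0)) \<in> underS a (k (f'(p := 0)))" if "omega_less W (f(p := 0)) (f'(p := 0))"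
        using k_less[OF red[OF U(1)[OF f(1)]] c1[OF f(1)] red[OF U(1)[OF f']] c1[OF f'] that] .
      have e: "f = f'" if "f p = Suc n" "f' p = Suc n" using U(4)[OF f(1) that(1)] U(4)[OF f' that(2)] by simp
      have ne: "f \<noteq> f'" using f(2) omega_less_irrefl by blast
      note F0 = kF[OF U(1)[OF f(1)] c0[OF f(1)]] kF[OF red[OF U(1)[OF f(1)]] c1[OF f(1)]]
        kF[OF U(1)[OF f'] c0[OF f']] kF[OF red[OF U(1)[OF f']] c1[OF f']] b0
      consider "f p < n" "f' p < n" | "f p < n" "f' p \<ge> n" | "f p = n" "f' p = n" | "f p = n" "f' p = Suc n"
        using lessD[OF f(1) f' f(2)] U(2)[OF f(1)] U(2)[OF f'] e ne by linarith
      thus "h f \<in> underS (osum_list [a, a, b]) (h f')"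
      proof cases
        case 1 thus ?thesis using F0 kk unfolding h_def by (simp add: underS_osum_list)
      next
        case 2 thus ?thesis using F0 unfolding h_def by (simp add: underS_osum_list)
      next
        case 3
        thus ?thesis using F0 kk' lessD[OF f(1) f' f(2)] unfolding h_def by (simp add: underS_osum_list)
      next
        case 4 thus ?thesis using F0 unfolding h_def by (simp add: underS_osum_list)
      qed
    qed
    hence "?U \<le>o osum_list [a, a, b]"
      by (rule strict_map_ordLeq[OF Well_order_Restr[OF woO] Well_order_osum_list, rotated]) (simp add: ab)
    hence "?U \<le>o g" using ab(5) ordLeq_transitive by blast
    hence "?U \<le>o Restr ?O (underS ?O F)" using F(2) ordLeq_ordIso_trans by blast
    moreover have "Restr ?O (underS ?O F) <o ?U"
    proof -
      have "underS ?O F \<subset> under ?O ?G"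
      proof
        show "underS ?O F \<subseteq> under ?O ?G"
          using underS_le_trans[OF woO _ FG] by (auto simp: under_def underS_iff)
        show "underS ?O F \<noteq> under ?O ?G" using FG by (auto simp: under_def underS_iff)
      qed
      thus ?thesis using ofilter_subset_ordLess[OF woO, of "underS ?O F" "under ?O ?G"] woO
        by (simp add: wo_rel.underS_ofilter wo_rel.under_ofilter wo_rel_def)
    qed
    ultimately show False using not_ordLess_ordLeq by blast
  qed
  have "F = osingle p"
  proof (rule ccontr)
    assume nF: "F \<noteq> osingle p"
    have 1: "omega_less W (omul 1 p) F"
    proof -
      have "\<not> omega_less W F (omul 1 p)" using omega_less_omul_iff[OF W(1) pF F(1)] p(1) by simp
      thus ?thesis using omega_less_total[OF W(1) F(1) omul_fin_supp[OF pF]] nF mul1 by metis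
    qed
    have "omega_less W (omul (Suc n) p) F" for n
      by (induction n) (use 1 step in auto)
    hence "omega_less W (omul (Suc (F p)) p) F" .
    moreover have "omega_less W F (omul (Suc (F p)) p)" using omega_less_omul_iff[OF W(1) pF F(1)] Fp by simp
    ultimately show False using omega_less_trans[OF W(1)] omega_less_irrefl by blast
  qed
  hence gs: "g =o oexp_omega (Restr W (underS W p))" using F(2) oexp_omega_Restr[OF W(1) pF] by simp
  have woR: "Well_order (Restr W (underS W p))" using Well_order_Restr[OF W(1)] .
  \<comment> \<open>The exponent found lies over the large type of \<open>W\<close>. Being at most
    its own power, it is at most \<open>g\<close> and can be moved to the type of
    \<open>g\<close>.\<close>
  have "Restr W (underS W p) \<le>o g"
    using ordLeq_oexp_omega[OF woR] ordIso_symmetric[OF gs] ordLeq_ordIso_trans by blast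
  then obtain e :: "'u rel" where e: "Well_order e" "Restr W (underS W p) =o e" by (rule ordLeq_transport)
  have "oexp_omega (Restr W (underS W p)) =o oexp_omega e"
    using e(2) by (rule oexp_omega_cong)
  thus ?thesis using that e(1) gs ordIso_transitive by blast
qed

text \<open>Every rank is bounded by the width of some residual, and
  \<open>width_prod_double\<close> fits two copies of that residual and a further point into the
  product; this is the doubling condition of \<open>indecomposable_oexp_omega\<close>.\<close>

lemma width_prod_oexp_omega:
  fixes e :: "nat \<Rightarrow> 'b rel"
  assumes wo: "\<forall>i<n. Well_order (e i)"
  obtains d :: "(nat \<Rightarrow> 'b \<Rightarrow> nat) list set rel" where "Well_order d"
    "width (prod_le n (\<lambda>i. oexp_omega (e i))) (prod_carrier n (\<lambda>i. oexp_omega (e i))) =o oexp_omega d"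
proof -
  define le where "le = prod_le n (\<lambda>i. oexp_omega (e i))"
  define X where "X = prod_carrier n (\<lambda>i. oexp_omega (e i))"
  have wqo: "wqo le X" unfolding le_def X_def
    by (rule wqo_prod) (use wo Well_order_oexp_omega in blast)
  have "(\<lambda>i. if i < n then (\<lambda>_. 0) else undefined) \<in> X"
    by (simp add: X_def prod_carrier_def Field_oexp_omega zero_fin_supp)
  hence ne: "Field (width le X) \<noteq> {}" by (rule width_nonempty[OF wqo])
  show ?thesis
  proof (rule indecomposable_oexp_omega[OF width_rank(1)[OF wqo] ne])
    fix \<gamma> assume "\<gamma> \<in> Field (width le X)"
    then obtain x where x: "x \<in> X"
      "Restr (width le X) (underS (width le X) \<gamma>) \<le>o width le {y \<in> X. incomp le x y}"
      by (rule underS_width_ordLeq[OF wqo])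
    obtain y0 where y0: "y0 \<in> X"
      "osum_list [width le {y \<in> X. incomp le x y}, width le {y \<in> X. incomp le x y}, width le {y0}] \<le>o width le X"
      using width_prod_double[OF wo, of x] x(1) unfolding le_def X_def by blast
    have w: "wqo le {y \<in> X. incomp le x y}" "wqo le {y0}" using y0(1) by (auto intro: wqo_subset[OF wqo])
    show "\<exists>(a :: (nat \<Rightarrow> 'b \<Rightarrow> nat) list set rel) b. Well_order a \<and> Well_order b \<and> Field b \<noteq> {} \<and>
      Restr (width le X) (underS (width le X) \<gamma>) \<le>o a \<and> osum_list [a, a, b] \<le>o width le X"
      using width_rank(1)[OF w(1)] width_rank(1)[OF w(2)] width_nonempty[OF w(2) singletonI] x(2) y0(2)
      by (intro exI[of _ "width le {y \<in> X. incomp le x y}"] exI[of _ "width le {y0}"] conjI)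
  qed (use that[folded le_def X_def] in blast)
qed

section \<open>Natural sums of powers of omega\<close>

text \<open>The natural sum of the powers whose exponents are listed in \<open>ps\<close>, with
  repetitions counted.\<close>

definition osingles :: "'b list \<Rightarrow> 'b \<Rightarrow> nat" where
  "osingles ps = (\<lambda>x. \<Sum>j<length ps. osingle (ps ! j) x)"

lemma osingles_take_Suc:
  "i < length ps \<Longrightarrow> osingles (take (Suc i) ps) = oadd (osingles (take i ps)) (osingle (ps ! i))"
  by (rule ext) (simp add: osingles_def oadd_def min.absorb2)

lemma osingles_fin_supp:
  assumes "set ps \<subseteq> Field r"
  shows "osingles ps \<in> fin_supp r"
proof -
  have "osingles (take i ps) \<in> fin_supp r" if "i \<le> length ps" for i
    using that
  proof (induction i)
    case 0 show ?case by (simp add: osingles_def zero_fin_supp)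
  next
    case (Suc i)
    hence "ps ! i \<in> Field r" using assms by (meson Suc_le_eq nth_mem subsetD)
    thus ?case using Suc osingles_take_Suc[of i ps] oadd_fin_supp osingle_fin_supp
      by (metis Suc_le_eq less_imp_le_nat)
  qed
  from this[of "length ps"] show ?thesis by simp
qed

lemma osingles_nonzero:
  assumes "osingles ps x \<noteq> 0"
  shows "x \<in> set ps"
proof (rule ccontr)
  assume "x \<notin> set ps"
  hence "osingle (ps ! j) x = 0" if "j < length ps" for j using that by (auto simp: osingle_def)
  thus False using assms by (simp add: osingles_def)
qed

lemma omega_less_oadd_cancel: "omega_less r (oadd h f) (oadd h g) \<longleftrightarrow> omega_less r f g"
  by (simp add: omega_less_def oadd_def)

text \<open>Division with remainder. No exponent of \<open>s\<close> is below \<open>p\<close>, so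
  an \<open>f\<close> from \<open>s\<close> up to s + omega^p must agree with \<open>s\<close> at
  and above \<open>p\<close>, and what is left of \<open>f\<close> lies below omega^p.\<close>

lemma oadd_split:
  assumes wo: "Well_order r" and p: "p \<in> Field r" and f: "f \<in> fin_supp r"
    and s: "\<And>x. s x \<noteq> 0 \<Longrightarrow> (p, x) \<in> r"
    and lt: "omega_less r f (oadd s (osingle p))" and ge: "\<not> omega_less r f s"
  obtains h where "h \<in> fin_supp r" "omega_less r h (osingle p)" "f = oadd s h"
proof -
  obtain x where x: "x \<in> Field r" "f x < s x + osingle p x"
    "\<And>y. y \<in> Field r \<Longrightarrow> x \<in> underS r y \<Longrightarrow> f y = s y + osingle p y"
    using lt unfolding omega_less_def oadd_def by blast
  have low: "s y = 0" if "y \<in> underS r p" for y using s[of y] underS_not_ge[OF wo that] by blast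
  have xp: "x = p"
  proof (cases rule: Well_order_cases[OF wo x(1) p])
    case 2
    hence "s x = 0" "osingle p x = 0" using low by (auto simp: osingle_def underS_iff)
    thus ?thesis using x(2) by simp
  next
    case 3
    have "f x < s x" using x(2) 3 by (auto simp: osingle_def underS_iff)
    moreover have "f y = s y" if "y \<in> Field r" "x \<in> underS r y" for y
      using x(3)[OF that] underS_trans'[OF wo 3 that(2)] by (auto simp: osingle_def underS_iff)
    ultimately show ?thesis using ge x(1) unfolding omega_less_def by blast
  qed simp
  have above: "f y = s y" if "p \<in> underS r y" for y
    using x(3)[of y] that xp underS_in_Field[OF that] by (auto simp: osingle_def underS_iff)
  have "\<not> f p < s p" using ge above p unfolding omega_less_def by blast
  hence fp: "f p = s p" using x(2) xp by (simp add: osingle_def)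
  \<comment> \<open>Truncation does no harm: \<open>f\<close> and \<open>s\<close> agree at and
    above \<open>p\<close>, and \<open>s\<close> vanishes below \<open>p\<close>.\<close>
  define h where "h = (\<lambda>y. f y - s y)"
  have sup: "y \<in> underS r p" if "h y \<noteq> 0" for y
  proof -
    have "f y \<noteq> 0" using that by (simp add: h_def)
    hence y: "y \<in> Field r" using f by (auto simp: fin_supp_def)
    show ?thesis
    proof (cases rule: Well_order_cases[OF wo y p])
      case 1 thus ?thesis using that fp by (simp add: h_def)
    next
      case 3 thus ?thesis using that above by (simp add: h_def)
    qed simp
  qed
  have "{y. h y \<noteq> 0} \<subseteq> {y. f y \<noteq> 0}" by (auto simp: h_def)
  moreover have "finite {y. f y \<noteq> 0}" using f by (simp add: fin_supp_def)
  ultimately have "finite {y. h y \<noteq> 0}" by (rule finite_subset)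
  moreover have "h y = 0" if "y \<notin> Field r" for y using f that by (simp add: fin_supp_def h_def)
  ultimately have hf: "h \<in> fin_supp r" by (simp add: fin_supp_def)
  have "f y = s y + h y" for y
  proof (cases "y \<in> Field r")
    case True
    show ?thesis
      by (cases rule: Well_order_cases[OF wo True p]) (use fp low above in \<open>auto simp: h_def\<close>)
  next
    case False
    hence "(p, y) \<notin> r" by (auto simp: Field_def)
    hence "s y = 0" using s[of y] by blast
    thus ?thesis by (simp add: h_def)
  qed
  hence "f = oadd s h" by (auto simp: oadd_def)
  moreover have "omega_less r h (osingle p)" using omega_less_osingle_iff[OF wo p hf] sup by blast
  ultimately show ?thesis using that hf by blast
qed

text \<open>For decreasing exponents the natural sum does not exceed the ordinal sum: the partial
  sums \<open>S i\<close> cut the segment into consecutive intervals, and \<open>oadd_split\<close>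
  identifies interval \<open>i\<close> with the power of exponent \<open>ps ! i\<close>.\<close>

lemma underS_osingles_ordLeq_osum_list:
  fixes W :: "'v rel" and es :: "'u rel list"
  assumes W: "Well_order W" and ps: "set ps \<subseteq> Field W"
    and sorted: "\<And>i j. i < j \<Longrightarrow> j < length ps \<Longrightarrow> (ps ! j, ps ! i) \<in> W"
    and len: "length es = length ps"
    and es: "\<And>i. i < length ps \<Longrightarrow> Restr W (underS W (ps ! i)) \<le>o es ! i"
  shows "Restr (oexp_omega W) (underS (oexp_omega W) (osingles ps)) \<le>o osum_list (map oexp_omega es)"
proof -
  let ?O = "oexp_omega W" and ?m = "length ps"
  have woO: "Well_order ?O" using Well_order_oexp_omega[OF W] .
  define S where "S i = osingles (take i ps)" for i
  have S: "S i \<in> fin_supp W" for i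
    unfolding S_def using ps by (intro osingles_fin_supp) (meson set_take_subset subset_trans)
  have S_Suc: "S (Suc i) = oadd (S i) (osingle (ps ! i))" if "i < ?m" for i
    unfolding S_def using osingles_take_Suc[OF that] .
  have pF: "ps ! i \<in> Field W" if "i < ?m" for i using ps that by auto
  have S_sup: "(ps ! i, x) \<in> W" if nz: "S i x \<noteq> 0" and i: "i < ?m" for i x
  proof -
    have "x \<in> set (take i ps)" using nz osingles_nonzero unfolding S_def by metis
    then obtain j where "j < i" "x = ps ! j" by (auto simp: in_set_conv_nth)
    thus ?thesis using sorted i by blast
  qed
  have woe: "Well_order (es ! i)" if "i < ?m" for i using es[OF that] ordLeq_Well_order_simp by blast
  have "\<forall>i. \<exists>k. i < ?m \<longrightarrow> strict_map (Restr ?O (underS ?O (osingle (ps ! i)))) (oexp_omega (es ! i)) k"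
  proof
    fix i
    show "\<exists>k. i < ?m \<longrightarrow> strict_map (Restr ?O (underS ?O (osingle (ps ! i)))) (oexp_omega (es ! i)) k"
    proof (cases "i < ?m")
      case True
      have "Restr ?O (underS ?O (osingle (ps ! i))) \<le>o oexp_omega (es ! i)"
        using oexp_omega_mono[OF es[OF True]] unfolding oexp_omega_Restr[OF W pF[OF True]] .
      then obtain k where "strict_map (Restr ?O (underS ?O (osingle (ps ! i)))) (oexp_omega (es ! i)) k"
        by (rule ordLeq_strict_map)
      thus ?thesis by blast
    qed simp
  qed
  then obtain k where k: "\<And>i. i < ?m \<Longrightarrow>
      strict_map (Restr ?O (underS ?O (osingle (ps ! i)))) (oexp_omega (es ! i)) (k i)" by metis
  \<comment> \<open>The interval containing \<open>f\<close>: the first \<open>i\<close> for which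
    \<open>f\<close> is below the next partial sum. The remainder \<open>rem f\<close> is the
    position inside that interval.\<close>
  define idx where "idx f = (LEAST i. omega_less W f (S (Suc i)))" for f
  define rem where "rem f = (\<lambda>x. f x - S (idx f) x)" for f
  have main: "idx f < ?m \<and> omega_less W f (S (Suc (idx f))) \<and> rem f \<in> underS ?O (osingle (ps ! idx f)) \<and>
      f = oadd (S (idx f)) (rem f)"
    if f: "f \<in> underS ?O (osingles ps)" for f
  proof -
    have f': "f \<in> fin_supp W" "omega_less W f (osingles ps)" using f by (auto simp: underS_oexp_omega)
    have n0: "\<not> omega_less W f (S 0)" by (auto simp: S_def osingles_def omega_less_def)
    have Sm: "S ?m = osingles ps" by (simp add: S_def)
    have "?m \<noteq> 0" using n0 f'(2) Sm by metis
    then obtain m' where m': "?m = Suc m'" by (cases ?m) auto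
    hence lm: "omega_less W f (S (Suc m'))" using f'(2) Sm by simp
    have 1: "omega_less W f (S (Suc (idx f)))" unfolding idx_def by (rule LeastI[of _ m']) (rule lm)
    have "idx f \<le> m'" unfolding idx_def by (rule Least_le) (rule lm)
    hence 2: "idx f < ?m" using m' by simp
    have 3: "\<not> omega_less W f (S (idx f))"
    proof (cases "idx f")
      case (Suc j)
      thus ?thesis using not_less_Least[of j "\<lambda>i. omega_less W f (S (Suc i))"] unfolding idx_def by simp
    qed (use n0 in simp)
    obtain h where h: "h \<in> fin_supp W" "omega_less W h (osingle (ps ! idx f))" "f = oadd (S (idx f)) h"
      by (rule oadd_split[OF W pF[OF 2] f'(1) S_sup[OF _ 2] 1[unfolded S_Suc[OF 2]] 3]) (assumption | rule that)+
    have "rem f = h" unfolding rem_def by (rule ext) (subst h(3), simp add: oadd_def)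
    thus ?thesis using 1 2 h osingle_fin_supp[OF pF[OF 2]] by (simp add: underS_oexp_omega)
  qed
  have wol: "\<forall>r\<in>set (map oexp_omega es). Well_order r"
  proof
    fix r assume "r \<in> set (map oexp_omega es)"
    then obtain i where "i < length es" "r = oexp_omega (es ! i)" by (auto simp: in_set_conv_nth)
    thus "Well_order r" using woe[of i] len Well_order_oexp_omega[of "es ! i"] by simp
  qed
  have "strict_map (Restr ?O (underS ?O (osingles ps))) (osum_list (map oexp_omega es)) (\<lambda>f. (idx f, k (idx f) (rem f)))"
    unfolding strict_map_def Field_Restr_underS[OF woO]
  proof (intro conjI ballI)
    fix g assume g: "g \<in> underS ?O (osingles ps)"
    have kF: "k (idx f) (rem f) \<in> Field (oexp_omega (es ! idx f))" if "f \<in> underS ?O (osingles ps)" for f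
      using main[OF that] k[of "idx f"] unfolding strict_map_def Field_Restr_underS[OF woO] by simp
    show "(idx g, k (idx g) (rem g)) \<in> Field (osum_list (map oexp_omega es))"
      unfolding Field_osum_list[OF wol] using kF[OF g] main[OF g] len by simp
    fix f assume "f \<in> underS (Restr ?O (underS ?O (osingles ps))) g"
    hence f: "f \<in> underS ?O (osingles ps)" "omega_less W f g" by (auto simp: underS_Restr underS_oexp_omega)
    have "omega_less W f (S (Suc (idx g)))" using omega_less_trans[OF W f(2)] main[OF g] by blast
    hence le: "idx f \<le> idx g" unfolding idx_def[of f] by (rule Least_le)
    have "k (idx f) (rem f) \<in> underS (oexp_omega (es ! idx f)) (k (idx g) (rem g))" if eq: "idx f = idx g"
    proof -
      have "omega_less W (oadd (S (idx g)) (rem f)) (oadd (S (idx g)) (rem g))"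
        using f(2) main[OF f(1)] main[OF g] eq by simp
      hence "omega_less W (rem f) (rem g)" by (simp add: omega_less_oadd_cancel)
      hence "rem f \<in> underS (Restr ?O (underS ?O (osingle (ps ! idx g)))) (rem g)"
        using main[OF f(1)] main[OF g] eq by (simp add: underS_Restr underS_oexp_omega)
      thus ?thesis using k[of "idx g"] main[OF g] eq
        unfolding strict_map_def Field_Restr_underS[OF woO] by simp
    qed
    thus "(idx f, k (idx f) (rem f)) \<in> underS (osum_list (map oexp_omega es)) (idx g, k (idx g) (rem g))"
      unfolding underS_osum_list using le main[OF f(1)] main[OF g] kF[OF f(1)] kF[OF g] len by auto
  qed
  thus ?thesis by (rule strict_map_ordLeq[OF Well_order_Restr[OF woO] Well_order_osum_list[OF wol]])
qed

text \<open>Only the class of the new element loses rank, and pointwise addition is strictly monotone.\<close>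

lemma width_partition_ordLeq:
  fixes W :: "'v rel" and A :: "'x set" and D :: "'x \<Rightarrow> 's" and \<theta> :: "'x \<Rightarrow> 'y"
  assumes wqo: "wqo le A" and W: "Well_order W" and fin: "finite G" and D: "\<And>x. x \<in> A \<Longrightarrow> D x \<in> G"
    and p: "\<And>s. s \<in> G \<Longrightarrow> p s \<in> Field W" and wqo': "\<And>s. s \<in> G \<Longrightarrow> wqo (ls s) (As s)"
    and \<theta>: "\<And>x. x \<in> A \<Longrightarrow> \<theta> x \<in> As (D x)"
    and inc: "\<And>x y. x \<in> A \<Longrightarrow> y \<in> A \<Longrightarrow> D x = D y \<Longrightarrow> incomp le x y \<Longrightarrow> incomp (ls (D x)) (\<theta> x) (\<theta> y)"
    and w: "\<And>s. s \<in> G \<Longrightarrow>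
      width (ls s) (As s) \<le>o Restr (oexp_omega W) (underS (oexp_omega W) (osingle (p s)))"
  shows "width le A \<le>o Restr (oexp_omega W) (underS (oexp_omega W) (\<lambda>x. \<Sum>s\<in>G. osingle (p s) x))"
proof -
  let ?O = "oexp_omega W"
  have woO: "Well_order ?O" using Well_order_oexp_omega[OF W] .
  have "\<forall>s. \<exists>k. s \<in> G \<longrightarrow> strict_map (width (ls s) (As s)) (Restr ?O (underS ?O (osingle (p s)))) k"
    using w ordLeq_strict_map by metis
  then obtain k where k: "\<And>s. s \<in> G \<Longrightarrow>
      strict_map (width (ls s) (As s)) (Restr ?O (underS ?O (osingle (p s)))) (k s)" by metis
  define part where "part s xs = map \<theta> (filter (\<lambda>x. D x = s) xs)" for s xs
  \<comment> \<open>\<open>inc_seqs\<close> has no empty sequence. An empty trace therefore gets the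
    value \<open>osingle (p s)\<close>, strictly above the images of all ranks of nonempty traces in
    class \<open>s\<close>.\<close>
  define v where "v s xs = (if part s xs = [] then osingle (p s)
      else k s (width_rank (ls s) (As s) (part s xs)))" for s xs
  define good where "good xs \<longleftrightarrow> set xs \<subseteq> A \<and> sorted_wrt (incomp le) xs" for xs
  have part: "part s xs \<in> inc_seqs (ls s) (As s)" if "good xs" "part s xs \<noteq> []" for s xs
  proof -
    have sub: "set xs \<subseteq> A" and srt: "sorted_wrt (incomp le) xs" using that by (auto simp: good_def)
    have "sorted_wrt (incomp le) (filter (\<lambda>x. D x = s) xs)" using srt by (rule sorted_wrt_filter)
    moreover have "incomp (ls s) (\<theta> x) (\<theta> y)" if "x \<in> set (filter (\<lambda>x. D x = s) xs)"
      "y \<in> set (filter (\<lambda>x. D x = s) xs)" "incomp le x y" for x y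
      using inc[of x y] sub that by auto
    ultimately have "sorted_wrt (\<lambda>x y. incomp (ls s) (\<theta> x) (\<theta> y)) (filter (\<lambda>x. D x = s) xs)"
      by (rule sorted_wrt_mono_rel[rotated])
    moreover have "set (part s xs) \<subseteq> As s" using sub \<theta> by (auto simp: part_def)
    ultimately show ?thesis using that(2) by (simp add: inc_seqs_iff part_def sorted_wrt_map)
  qed
  have vk: "k s (width_rank (ls s) (As s) ys) \<in> underS ?O (osingle (p s))"
    if "s \<in> G" "ys \<in> inc_seqs (ls s) (As s)" for s ys
  proof -
    have "width_rank (ls s) (As s) ys \<in> Field (width (ls s) (As s))"
      using that(2) unfolding width_rank(2)[OF wqo'[OF that(1)], symmetric] by (rule imageI)
    thus ?thesis using k[OF that(1)] unfolding strict_map_def Field_Restr_underS[OF woO] by simp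
  qed
  have vf: "v s xs \<in> fin_supp W" if "good xs" "s \<in> G" for s xs
    using vk[OF that(2) part[OF that(1)]] osingle_fin_supp[OF p[OF that(2)]]
    by (auto simp: v_def underS_oexp_omega)
  define \<sigma> where "\<sigma> xs = (\<lambda>x. \<Sum>s\<in>G. v s xs x)" for xs
  have sum_fin: "(\<lambda>x. \<Sum>s\<in>H. g s x) \<in> fin_supp W"
    if "finite H" "\<And>s. s \<in> H \<Longrightarrow> g s \<in> fin_supp W" for H :: "'s set" and g
    using that
  proof (induction H rule: finite_induct)
    case empty show ?case by (simp add: zero_fin_supp)
  next
    case (insert s H)
    have "oadd (g s) (\<lambda>x. \<Sum>s\<in>H. g s x) \<in> fin_supp W" using insert by (intro oadd_fin_supp) auto
    thus ?case using insert by (simp add: oadd_def)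
  qed
  have \<sigma>f: "\<sigma> xs \<in> fin_supp W" if "good xs" for xs
    unfolding \<sigma>_def using fin vf[OF that] by (rule sum_fin)
  have step: "\<sigma> (xs @ [z]) \<in> underS ?O (\<sigma> xs)" if g: "good (xs @ [z])" for xs z
  proof -
    have gx: "good xs" using g by (auto simp: good_def sorted_wrt_append)
    have zA: "z \<in> A" using g by (simp add: good_def)
    define s where "s = D z"
    have sG: "s \<in> G" using D[OF zA] by (simp add: s_def)
    have same: "v t (xs @ [z]) = v t xs" if "t \<noteq> s" for t
      using that by (simp add: v_def part_def s_def)
    have ps: "part s (xs @ [z]) = part s xs @ [\<theta> z]" by (simp add: part_def s_def)
    have i: "part s xs @ [\<theta> z] \<in> inc_seqs (ls s) (As s)" using part[OF g, of s] ps by simp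
    have "v s (xs @ [z]) \<in> underS ?O (v s xs)"
    proof (cases "part s xs = []")
      case True
      thus ?thesis using vk[OF sG i] ps by (simp add: v_def)
    next
      case False
      let ?r = "width_rank (ls s) (As s)"
      have j: "part s xs \<in> inc_seqs (ls s) (As s)" using part[OF gx False] .
      have "?r (part s xs @ [\<theta> z]) \<in> underS (width (ls s) (As s)) (?r (part s xs))"
        using width_rank(3)[OF wqo'[OF sG] j i] by simp
      hence "k s (?r (part s xs @ [\<theta> z])) \<in> underS (Restr ?O (underS ?O (osingle (p s)))) (k s (?r (part s xs)))"
        using k[OF sG] underS_in_Field unfolding strict_map_def by metis
      thus ?thesis using False ps by (simp add: v_def underS_Restr)
    qed
    hence lt: "omega_less W (v s (xs @ [z])) (v s xs)" by (simp add: underS_oexp_omega)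
    have split: "\<sigma> ys = oadd (\<lambda>x. \<Sum>t\<in>G - {s}. v t ys x) (v s ys)" for ys
      unfolding \<sigma>_def oadd_def by (rule ext) (simp add: sum.remove[OF fin sG])
    have "(\<lambda>x. \<Sum>t\<in>G - {s}. v t (xs @ [z]) x) = (\<lambda>x. \<Sum>t\<in>G - {s}. v t xs x)"
      by (rule ext, rule sum.cong) (use same in auto)
    hence "omega_less W (\<sigma> (xs @ [z])) (\<sigma> xs)"
      using omega_less_oadd[OF lt] by (simp add: split)
    thus ?thesis using \<sigma>f[OF gx] \<sigma>f[OF g] by (simp add: underS_oexp_omega)
  qed
  \<comment> \<open>Before anything is played each class contributes its full power, so the value of
    the empty sequence is exactly the claimed bound, and all nonempty antichains lie below
    it.\<close>
  have \<sigma>0: "\<sigma> [] = (\<lambda>x. \<Sum>s\<in>G. osingle (p s) x)" by (simp add: \<sigma>_def v_def part_def)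
  have below: "\<sigma> xs \<in> underS ?O (\<sigma> [])" if "good xs" "xs \<noteq> []" for xs
    using that(2,1)
  proof (induction xs rule: rev_nonempty_induct)
    case (single z) thus ?case using step[of "[]" z] by simp
  next
    case (snoc z xs)
    have "good xs" using snoc.prems by (auto simp: good_def sorted_wrt_append)
    thus ?case using snoc.IH step[OF snoc.prems] underS_trans'[OF woO] by blast
  qed
  have gT: "good xs" "xs \<noteq> []" if "xs \<in> inc_seqs le A" for xs using that by (auto simp: inc_seqs_iff good_def)
  show ?thesis unfolding \<sigma>0[symmetric]
  proof (rule width_upper[OF wqo Well_order_Restr[OF woO], where \<sigma> = \<sigma>])
    show "\<sigma> xs \<in> Field (Restr ?O (underS ?O (\<sigma> [])))" if "xs \<in> inc_seqs le A" for xs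
      unfolding Field_Restr_underS[OF woO] using below gT[OF that] by blast
    show "\<sigma> (xs @ [z]) \<in> underS (Restr ?O (underS ?O (\<sigma> []))) (\<sigma> xs)"
      if "xs \<in> inc_seqs le A" "xs @ [z] \<in> inc_seqs le A" for xs z
      using below gT[OF that(1)] gT[OF that(2)] step by (simp add: underS_Restr)
  qed
qed

lemma osum_list_singleton:
  assumes wo: "Well_order r"
  shows "r =o osum_list [r]"
proof -
  have l: "\<forall>r\<in>set [r]. Well_order r" using wo by simp
  have "strict_map r (osum_list [r]) (Pair 0)"
    unfolding strict_map_def Field_osum_list[OF l] by (auto simp: underS_osum_list dest: underS_in_Field)
  moreover have "strict_map (osum_list [r]) r snd"
    unfolding strict_map_def Field_osum_list[OF l] by (auto simp: underS_osum_list)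
  ultimately show ?thesis
    unfolding ordIso_iff_ordLeq using strict_map_ordLeq wo Well_order_osum_list[OF l] by metis
qed

text \<open>A linear extension of \<open>prec\<close> on \<open>G\<close>: sorting by the number of
  predecessors works because that number strictly increases along \<open>prec\<close>.\<close>

lemma ex_list_respecting_order:
  assumes fin: "finite G" and irr: "\<And>x. \<not> prec x x"
    and tr: "\<And>x y z. prec x y \<Longrightarrow> prec y z \<Longrightarrow> prec x z"
  obtains xs where "set xs = G" "distinct xs" "\<And>i j. i < j \<Longrightarrow> j < length xs \<Longrightarrow> \<not> prec (xs ! j) (xs ! i)"
proof -
  define key where "key x = card {y \<in> G. prec y x}" for x
  have key: "key x < key y" if "x \<in> G" "prec x y" for x y
    unfolding key_def
  proof (rule psubset_card_mono)
    show "finite {z \<in> G. prec z y}" using fin by simp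
    show "{z \<in> G. prec z x} \<subset> {z \<in> G. prec z y}" using that tr irr by blast
  qed
  obtain ys where ys: "set ys = G" "distinct ys" using finite_distinct_list[OF fin] by blast
  let ?xs = "sort_key key ys"
  show ?thesis
  proof (rule that)
    show "set ?xs = G" "distinct ?xs" using ys by simp_all
    show "\<not> prec (?xs ! j) (?xs ! i)" if ij: "i < j" "j < length ?xs" for i j
    proof
      assume "prec (?xs ! j) (?xs ! i)"
      moreover have "?xs ! j \<in> G" using nth_mem[OF ij(2)] ys(1) by simp
      ultimately have "key (?xs ! j) < key (?xs ! i)" by (rule key[rotated])
      moreover have "map key ?xs ! i \<le> map key ?xs ! j"
        using ij by (intro sorted_nth_mono[OF sorted_sort_key]) simp_all
      ultimately show False using ij by simp
    qed
  qed
qed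

section \<open>Slices of a product\<close>

locale sliced_product =
  fixes n :: nat and \<alpha> :: "nat \<Rightarrow> 'a rel" and E :: "nat \<Rightarrow> 'a rel list"
    and h :: "nat \<Rightarrow> 'a \<Rightarrow> nat \<times> ('a \<Rightarrow> nat)"
  assumes n_pos: "n \<ge> 1"
    and wo_\<alpha>: "\<And>i. i < n \<Longrightarrow> Well_order (\<alpha> i)"
    and inf_\<alpha>: "\<And>i. i < n \<Longrightarrow> infinite (Field (\<alpha> i))"
    and wo_E: "\<And>i j. i < n \<Longrightarrow> j < length (E i) \<Longrightarrow> Well_order (E i ! j)"
    and E_Suc: "\<And>i k. i < n \<Longrightarrow> Suc k < length (E i) \<Longrightarrow> E i ! Suc k \<le>o E i ! k"
    and h: "\<And>i. i < n \<Longrightarrow> iso (\<alpha> i) (osum_list (map oexp_omega (E i))) (h i)"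
begin

definition slices :: "(nat \<Rightarrow> nat) set" where
  "slices = {s. (\<forall>i<n. s i < length (E i)) \<and> (\<forall>i\<ge>n. s i = 0)}"

definition ground :: "(nat \<Rightarrow> nat) set" where
  "ground = {s \<in> slices. \<exists>k<n. s k = 0}"

abbreviation X where "X \<equiv> prod_carrier n \<alpha>"
abbreviation leX where "leX \<equiv> prod_le n \<alpha>"
abbreviation slice where "slice s \<equiv> prod_carrier n (\<lambda>i. oexp_omega (E i ! s i))"
abbreviation le_slice where "le_slice s \<equiv> prod_le n (\<lambda>i. oexp_omega (E i ! s i))"
abbreviation slice_width where "slice_width s \<equiv> width (le_slice s) (slice s)"

text \<open>\<open>index x\<close> is the slice containing \<open>x\<close> and \<open>pos x\<close>
  the place of \<open>x\<close> inside it. By \<open>le_X_iff\<close> each coordinate is ordered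
  lexicographically by these two. The values from \<open>n\<close> on are those required by
  \<open>slices\<close> and by \<open>prod_carrier\<close>.\<close>

definition index :: "(nat \<Rightarrow> 'a) \<Rightarrow> nat \<Rightarrow> nat" where
  "index x = (\<lambda>i. if i < n then fst (h i (x i)) else 0)"

definition pos :: "(nat \<Rightarrow> 'a) \<Rightarrow> nat \<Rightarrow> 'a \<Rightarrow> nat" where
  "pos x = (\<lambda>i. if i < n then snd (h i (x i)) else undefined)"

lemma E_antimono:
  assumes "i < n" "j \<le> k" "k < length (E i)"
  shows "E i ! k \<le>o E i ! j"
  using assms(2,3)
proof (induction k rule: dec_induct)
  case base show ?case using ordLeq_reflexive[OF wo_E[OF assms(1) base]] .
next
  case (step k)
  thus ?case using E_Suc[OF assms(1) step.prems] ordLeq_transitive by (metis Suc_lessD)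
qed

lemma wo_powers: "i < n \<Longrightarrow> \<forall>r\<in>set (map oexp_omega (E i)). Well_order r"
  using wo_E[of i] Well_order_oexp_omega by (fastforce simp: in_set_conv_nth)

lemma Field_powers: "i < n \<Longrightarrow> Field (osum_list (map oexp_omega (E i))) =
    {(j, c). j < length (E i) \<and> c \<in> fin_supp (E i ! j)}"
  unfolding Field_osum_list[OF wo_powers] by (auto simp: Field_oexp_omega)

lemma h_bij: "i < n \<Longrightarrow> bij_betw (h i) (Field (\<alpha> i)) (Field (osum_list (map oexp_omega (E i))))"
  using h unfolding iso_iff2 by simp

lemma h_in:
  assumes "i < n" "a \<in> Field (\<alpha> i)"
  shows "fst (h i a) < length (E i)" "snd (h i a) \<in> fin_supp (E i ! fst (h i a))"
proof -
  have "h i a \<in> Field (osum_list (map oexp_omega (E i)))"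
    using h_bij[OF assms(1)] assms(2) by (auto simp: bij_betw_def)
  thus "fst (h i a) < length (E i)" "snd (h i a) \<in> fin_supp (E i ! fst (h i a))"
    unfolding Field_powers[OF assms(1)] by auto
qed

lemma h_le:
  assumes "i < n" "a \<in> Field (\<alpha> i)" "b \<in> Field (\<alpha> i)"
  shows "(a, b) \<in> \<alpha> i \<longleftrightarrow> fst (h i a) < fst (h i b) \<or>
    (fst (h i a) = fst (h i b) \<and> (snd (h i a), snd (h i b)) \<in> oexp_omega (E i ! fst (h i a)))"
proof -
  have "(a, b) \<in> \<alpha> i \<longleftrightarrow> (h i a, h i b) \<in> osum_list (map oexp_omega (E i))"
    using h[OF assms(1)] assms unfolding iso_iff2 by blast
  thus ?thesis using h_in[OF assms(1,2)] h_in[OF assms(1,3)]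
    by (cases "h i a"; cases "h i b") (auto simp: osum_list_def Field_oexp_omega)
qed

lemma h_surj:
  assumes "i < n" "j < length (E i)" "c \<in> fin_supp (E i ! j)"
  obtains a where "a \<in> Field (\<alpha> i)" "h i a = (j, c)"
proof -
  have "(j, c) \<in> h i ` Field (\<alpha> i)"
    using h_bij[OF assms(1)] assms Field_powers[OF assms(1)] by (simp add: bij_betw_def)
  thus ?thesis using that by (auto simp: image_iff)
qed

lemma index_slices: "x \<in> X \<Longrightarrow> index x \<in> slices"
  using h_in(1) by (simp add: slices_def index_def prod_carrier_def)

lemma pos_slice: "x \<in> X \<Longrightarrow> pos x \<in> slice (index x)"
  using h_in(2) by (simp add: prod_carrier_def pos_def index_def Field_oexp_omega)

lemma le_X_iff:
  assumes "x \<in> X" "y \<in> X" "i < n"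
  shows "(x i, y i) \<in> \<alpha> i \<longleftrightarrow> index x i < index y i \<or>
    (index x i = index y i \<and> (pos x i, pos y i) \<in> oexp_omega (E i ! index x i))"
  using h_le[of i "x i" "y i"] assms by (simp add: index_def pos_def prod_carrier_def)

lemma incomp_same_index:
  assumes "x \<in> X" "y \<in> X" "index x = index y"
  shows "incomp leX x y \<longleftrightarrow> incomp (le_slice (index x)) (pos x) (pos y)"
proof -
  have "(x i, y i) \<in> \<alpha> i \<longleftrightarrow> (pos x i, pos y i) \<in> oexp_omega (E i ! index x i)"
    "(y i, x i) \<in> \<alpha> i \<longleftrightarrow> (pos y i, pos x i) \<in> oexp_omega (E i ! index x i)" if "i < n" for i
    using le_X_iff[OF assms(1,2) that] le_X_iff[OF assms(2,1) that] assms(3) by auto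
  moreover have "pos y \<in> slice (index x)" using pos_slice[OF assms(2)] assms(3) by simp
  ultimately show ?thesis
    unfolding incomp_prod_iff[OF assms(1,2)] incomp_prod_iff[OF pos_slice[OF assms(1)] \<open>pos y \<in> slice (index x)\<close>]
    by blast
qed

lemma ex_element:
  assumes s: "s \<in> slices" and c: "c \<in> slice s"
  shows "\<exists>x\<in>X. index x = s \<and> pos x = c"
proof -
  have "\<exists>a. a \<in> Field (\<alpha> i) \<and> h i a = (s i, c i)" if "i < n" for i
  proof -
    have "s i < length (E i)" "c i \<in> fin_supp (E i ! s i)"
      using s c that by (auto simp: slices_def prod_carrier_def Field_oexp_omega)
    thus ?thesis using h_surj[OF that] by metis
  qed
  then obtain a where a: "\<And>i. i < n \<Longrightarrow> a i \<in> Field (\<alpha> i) \<and> h i (a i) = (s i, c i)" by metis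
  define x where "x i = (if i < n then a i else undefined)" for i
  have "x \<in> X" using a by (simp add: x_def prod_carrier_def)
  moreover have "index x = s" using a s by (auto simp: index_def x_def slices_def)
  moreover have "pos x = c" using a c by (auto simp: pos_def x_def prod_carrier_def)
  ultimately show ?thesis by blast
qed

lemma wqo_X: "wqo leX X"
  by (rule wqo_prod) (simp add: wo_\<alpha>)

lemma wo_slice: "s \<in> slices \<Longrightarrow> i < n \<Longrightarrow> Well_order (E i ! s i)"
  using wo_E by (simp add: slices_def)

lemma wqo_slice: "s \<in> slices \<Longrightarrow> wqo (le_slice s) (slice s)"
  by (rule wqo_prod) (simp add: wo_slice Well_order_oexp_omega)

lemma ground_slices: "s \<in> ground \<Longrightarrow> s \<in> slices"
  by (simp add: ground_def)

lemma finite_ground: "finite ground"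
proof -
  let ?N = "Max ((\<lambda>i. length (E i)) ` {..<n})"
  have "s i \<le> ?N" if "s \<in> slices" for s i
  proof (cases "i < n")
    case True
    have "length (E i) \<le> ?N" using True by (intro Max_ge) auto
    moreover have "s i < length (E i)" using that True by (simp add: slices_def)
    ultimately show ?thesis by linarith
  next
    case False thus ?thesis using that by (simp add: slices_def)
  qed
  hence "ground \<subseteq> {s. \<forall>i. (i \<in> {..<n} \<longrightarrow> s i \<in> {..?N}) \<and> (i \<notin> {..<n} \<longrightarrow> s i = 0)}"
    by (auto simp: ground_def slices_def)
  moreover have "finite {s. \<forall>i. (i \<in> {..<n} \<longrightarrow> s i \<in> {..?N}) \<and> (i \<notin> {..<n} \<longrightarrow> s i = 0)}"
    by (rule finite_set_of_finite_funs) simp_all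
  ultimately show ?thesis by (rule finite_subset)
qed

text \<open>Exponents weakly decrease along \<open>E i\<close>, so a later block embeds into every
  earlier one.\<close>

definition lower :: "nat \<Rightarrow> nat \<Rightarrow> nat \<Rightarrow> ('a \<Rightarrow> nat) \<Rightarrow> 'a \<Rightarrow> nat" where
  "lower i k j = (SOME f. strict_map (oexp_omega (E i ! k)) (oexp_omega (E i ! j)) f)"

lemma strict_map_lower:
  assumes "i < n" "j \<le> k" "k < length (E i)"
  shows "strict_map (oexp_omega (E i ! k)) (oexp_omega (E i ! j)) (lower i k j)"
proof -
  obtain f where "strict_map (oexp_omega (E i ! k)) (oexp_omega (E i ! j)) f"
    using oexp_omega_mono[OF E_antimono[OF assms]] by (rule ordLeq_strict_map)
  thus ?thesis unfolding lower_def
    by (rule someI[where P = "strict_map (oexp_omega (E i ! k)) (oexp_omega (E i ! j))"])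
qed

lemma strict_map_lower_slice:
  assumes "s \<in> slices" "\<And>i. i < n \<Longrightarrow> t i \<le> s i"
  shows "\<forall>i<n. strict_map (oexp_omega (E i ! s i)) (oexp_omega (E i ! t i)) (lower i (s i) (t i))"
  using assms strict_map_lower by (simp add: slices_def)

lemma lower_incomp:
  assumes s: "s \<in> slices" and t: "t \<in> slices" and le: "\<And>i. i < n \<Longrightarrow> t i \<le> s i"
    and z: "z \<in> slice s" "z' \<in> slice s"
  shows "incomp (le_slice t) (prod_map n (\<lambda>i. lower i (s i) (t i)) z) (prod_map n (\<lambda>i. lower i (s i) (t i)) z')
    \<longleftrightarrow> incomp (le_slice s) z z'"
  by (rule prod_map_incomp[OF strict_map_lower_slice[OF s le] _ _ z])
    (simp_all add: wo_slice[OF s] wo_slice[OF t] Well_order_oexp_omega)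

lemma slice_width_antimono:
  assumes s: "s \<in> slices" and t: "t \<in> slices" and le: "\<And>i. i < n \<Longrightarrow> t i \<le> s i"
  shows "slice_width s \<le>o slice_width t"
proof (rule width_mono[OF wqo_slice[OF s] wqo_slice[OF t], of "prod_map n (\<lambda>i. lower i (s i) (t i))"])
  show "prod_map n (\<lambda>i. lower i (s i) (t i)) ` slice s \<subseteq> slice t"
    using prod_map_carrier[OF strict_map_lower_slice[OF s le]] by blast
qed (simp add: lower_incomp[OF s t le])

text \<open>The number of steps (1,...,1) by which the slice of \<open>x\<close> lies above the
  ground.\<close>

definition height :: "(nat \<Rightarrow> 'a) \<Rightarrow> nat" where
  "height x = Min (index x ` {..<n})"

text \<open>The ground slice below \<open>x\<close> on its diagonal. By \<open>height_le\<close> the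
  subtraction is exact for coordinates below \<open>n\<close>; beyond them \<open>index x\<close> is
  0 and stays 0.\<close>

definition diagonal :: "(nat \<Rightarrow> 'a) \<Rightarrow> nat \<Rightarrow> nat" where
  "diagonal x = (\<lambda>i. index x i - height x)"

lemma height_le: "i < n \<Longrightarrow> height x \<le> index x i"
  unfolding height_def by (intro Min_le) auto

lemma diagonal_ground:
  assumes "x \<in> X"
  shows "diagonal x \<in> ground"
proof -
  have "height x \<in> index x ` {..<n}" unfolding height_def using n_pos by (intro Min_in) (auto simp: lessThan_empty_iff)
  then obtain k where "k < n" "index x k = height x" by auto
  hence "\<exists>k<n. diagonal x k = 0" by (auto simp: diagonal_def)
  moreover have "diagonal x \<in> slices"
    using index_slices[OF assms] by (auto simp: slices_def diagonal_def intro: le_less_trans)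
  ultimately show ?thesis by (simp add: ground_def)
qed

text \<open>The slices on a common diagonal are stacked on top of each other, so an antichain meets only
  one of them; and each of them embeds into the lowest one.\<close>

lemma incomp_diagonal_index:
  assumes x: "x \<in> X" "y \<in> X" and d: "diagonal x = diagonal y" and inc: "incomp leX x y"
  shows "index x = index y"
proof -
  have eq: "index z i = diagonal z i + height z" if "i < n" for z i
    using height_le[OF that, of z] by (simp add: diagonal_def)
  have not_less: "\<not> height u < height w"
    if u: "u \<in> X" "w \<in> X" "diagonal u = diagonal w" "incomp leX u w" for u w
  proof
    assume "height u < height w"
    hence "index u i < index w i" if "i < n" for i using eq[OF that] u(3) by simp
    hence "(u i, w i) \<in> \<alpha> i" if "i < n" for i using le_X_iff[OF u(1,2) that] that by blast
    thus False using u(4) unfolding incomp_prod_iff[OF u(1,2)] by blast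
  qed
  have "incomp leX y x" using inc by (auto simp: incomp_def)
  hence "height x = height y" using not_less[OF x d inc] not_less[OF x(2,1) d[symmetric]] by simp
  hence "index x i = index y i" if "i < n" for i using eq[OF that] d by simp
  moreover have "index x i = index y i" if "\<not> i < n" for i using that by (simp add: index_def)
  ultimately show ?thesis by blast
qed

section \<open>Upper bound by projection along the diagonals\<close>

lemma width_X_upper:
  assumes W: "Well_order W" and p: "\<And>s. s \<in> ground \<Longrightarrow> p s \<in> Field W"
    and w: "\<And>s. s \<in> ground \<Longrightarrow>
      slice_width s \<le>o Restr (oexp_omega W) (underS (oexp_omega W) (osingle (p s)))"
  shows "width leX X \<le>o Restr (oexp_omega W) (underS (oexp_omega W) (\<lambda>x. \<Sum>s\<in>ground. osingle (p s) x))"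
proof -
  define \<theta> where "\<theta> x = prod_map n (\<lambda>i. lower i (index x i) (diagonal x i)) (pos x)" for x
  have le: "diagonal x i \<le> index x i" for x i by (simp add: diagonal_def)
  show ?thesis
  proof (rule width_partition_ordLeq[OF wqo_X W finite_ground diagonal_ground p, where \<theta> = \<theta> and ls = le_slice and As = slice])
    show "wqo (le_slice s) (slice s)" if "s \<in> ground" for s using wqo_slice ground_slices that by blast
    show "\<theta> x \<in> slice (diagonal x)" if "x \<in> X" for x
      unfolding \<theta>_def using prod_map_carrier[OF strict_map_lower_slice[OF index_slices[OF that] le] pos_slice[OF that]] .
    show "incomp (le_slice (diagonal x)) (\<theta> x) (\<theta> y)"
      if xy: "x \<in> X" "y \<in> X" "diagonal x = diagonal y" "incomp leX x y" for x y
    proof -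
      have eq: "index x = index y" by (rule incomp_diagonal_index[OF xy])
      have "incomp (le_slice (index x)) (pos x) (pos y)" using incomp_same_index[OF xy(1,2) eq] xy(4) by simp
      moreover have "pos y \<in> slice (index x)" using pos_slice[OF xy(2)] eq by simp
      ultimately show ?thesis
        using lower_incomp[OF index_slices[OF xy(1)] ground_slices[OF diagonal_ground[OF xy(1)]] le pos_slice[OF xy(1)]]
        unfolding \<theta>_def eq[symmetric] xy(3)[symmetric] by blast
    qed
  qed (use w in simp_all)
qed

section \<open>Lower bound by playing the ground slices in turn\<close>

lemma leading_exponent_nonempty:
  assumes k: "k < n"
  shows "Field (E k ! 0) \<noteq> {}"
proof
  assume e: "Field (E k ! 0) = {}"
  \<comment> \<open>If the leading exponent were 0, all exponents would be 0, every block a single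
    point, and the factor finite.\<close>
  have "c = (\<lambda>_. 0)" if j: "j < length (E k)" and c: "c \<in> fin_supp (E k ! j)" for j c
  proof -
    obtain f where "strict_map (E k ! j) (E k ! 0) f"
      using E_antimono[OF k _ j, of 0] ordLeq_strict_map by blast
    hence "Field (E k ! j) = {}" using e by (auto simp: strict_map_def)
    thus ?thesis using c by (auto simp: fin_supp_def)
  qed
  hence "Field (osum_list (map oexp_omega (E k))) \<subseteq> {..<length (E k)} \<times> {\<lambda>_. 0}"
    unfolding Field_powers[OF k] by blast
  hence "finite (Field (osum_list (map oexp_omega (E k))))" by (rule finite_subset) simp
  thus False using bij_betw_finite[OF h_bij[OF k]] inf_\<alpha>[OF k] by blast
qed

lemma width_X_lower:
  assumes ss: "set ss = ground"
    and ord: "\<And>i j. i < j \<Longrightarrow> j < length ss \<Longrightarrow> \<exists>k<n. (ss ! i) k < (ss ! j) k"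
    and len: "length rs = length ss"
    and rs: "\<And>i. i < length ss \<Longrightarrow> rs ! i \<le>o slice_width (ss ! i)"
  shows "osum_list rs \<le>o width leX X"
proof (rule osum_list_ordLeq_width[OF wqo_X, of _ "\<lambda>i. {x \<in> X. index x = ss ! i}"])
  have "Well_order (rs ! i)" if "i < length ss" for i using rs[OF that] ordLeq_Well_order_simp by blast
  thus "\<forall>r\<in>set rs. Well_order r" using len by (auto simp: in_set_conv_nth)
  show "{x \<in> X. index x = ss ! i} \<subseteq> X" for i by blast
  fix i F assume i: "i < length rs" and F: "finite F"
    and sub: "F \<subseteq> (\<Union>j\<in>{i<..<length rs}. {x \<in> X. index x = ss ! j})"
  define s where "s = ss ! i"
  have sG: "s \<in> ground" using i len ss nth_mem unfolding s_def by metis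
  have sS: "s \<in> slices" using ground_slices[OF sG] .
  \<comment> \<open>The amount by which coordinate \<open>k\<close> is shifted. Only a zero
    coordinate of \<open>s\<close> is moved, and only past those played \<open>y\<close> that are in
    block 0 there as well; elsewhere the shift is 0.\<close>
  have "\<exists>N. N \<in> fin_supp (E k ! s k) \<and> (s k = 0 \<longrightarrow>
      (\<forall>y\<in>F. index y k = 0 \<longrightarrow> pos y k \<in> underS (oexp_omega (E k ! 0)) N))" if k: "k < n" for k
  proof (cases "s k = 0")
    case False thus ?thesis by (intro exI[of _ "\<lambda>_. 0"]) (simp add: zero_fin_supp)
  next
    case True
    let ?e = "E k ! 0" and ?D = "(\<lambda>y. pos y k) ` {y \<in> F. index y k = 0}"
    have wo: "Well_order ?e" using wo_slice[OF sS k] True by simp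
    note woO = Well_order_oexp_omega[OF wo]
    have "?D \<subseteq> Field (oexp_omega ?e)"
    proof clarify
      fix y assume y: "y \<in> F" "index y k = 0"
      hence "y \<in> X" using sub by auto
      thus "pos y k \<in> Field (oexp_omega ?e)" using pos_slice[of y] y(2) k by (auto simp: prod_carrier_def)
    qed
    moreover have "Field (oexp_omega ?e) \<noteq> {}" using zero_fin_supp[of ?e] by (auto simp: Field_oexp_omega)
    moreover have "finite ?D" using F by simp
    ultimately obtain m where "m \<in> Field (oexp_omega ?e)" and m2: "\<And>d. d \<in> ?D \<Longrightarrow> (d, m) \<in> oexp_omega ?e"
      using finite_subset_bounded[OF woO, of ?D] by blast
    hence m1: "m \<in> fin_supp ?e" by (simp add: Field_oexp_omega)
    \<comment> \<open>Adding omega^b to the bound \<open>m\<close> makes it strict; such a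
      \<open>b\<close> exists because the leading exponent is nonzero.\<close>
    obtain b where b: "b \<in> Field ?e" using leading_exponent_nonempty[OF k] by blast
    have "osingle b \<noteq> (\<lambda>_. 0)" by (auto simp: osingle_def fun_eq_iff)
    hence "m \<in> underS (oexp_omega ?e) (oadd m (osingle b))"
      using omega_less_oadd_self[OF wo osingle_fin_supp[OF b]] oadd_fin_supp[OF m1 osingle_fin_supp[OF b]] m1
      by (simp add: underS_oexp_omega)
    hence "pos y k \<in> underS (oexp_omega ?e) (oadd m (osingle b))" if "y \<in> F" "index y k = 0" for y
      using le_underS_trans[OF woO m2] that by blast
    thus ?thesis using oadd_fin_supp[OF m1 osingle_fin_supp[OF b]] True by auto
  qed
  then obtain N where N: "\<And>k. k < n \<Longrightarrow> N k \<in> fin_supp (E k ! s k)"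
    "\<And>k y. k < n \<Longrightarrow> s k = 0 \<Longrightarrow> y \<in> F \<Longrightarrow> index y k = 0 \<Longrightarrow> pos y k \<in> underS (oexp_omega (E k ! 0)) (N k)"
    by metis
  have sm: "\<forall>k<n. strict_map (oexp_omega (E k ! s k)) (oexp_omega (E k ! s k)) (oadd (N k))"
    using strict_map_oadd wo_slice[OF sS] N(1) by blast
  let ?sh = "prod_map n (\<lambda>k. oadd (N k))"
  have shS: "?sh z \<in> slice s" if "z \<in> slice s" for z using prod_map_carrier[OF sm that] .
  \<comment> \<open>\<open>g z\<close> is the element of \<open>X\<close> in slice \<open>s\<close>
    whose position is the shifted \<open>z\<close>, so the image of \<open>g\<close> is a copy of
    the whole slice clear of \<open>F\<close>.\<close>
  have "\<forall>z. \<exists>x. z \<in> slice s \<longrightarrow> x \<in> X \<and> index x = s \<and> pos x = ?sh z"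
    using ex_element[OF sS shS] by blast
  then obtain g where g: "\<And>z. z \<in> slice s \<Longrightarrow> g z \<in> X \<and> index (g z) = s \<and> pos (g z) = ?sh z" by metis
  have "slice_width s \<le>o width leX (g ` slice s)"
  proof (rule width_mono[OF wqo_slice[OF sS]])
    show "wqo leX (g ` slice s)" using g by (intro wqo_subset[OF wqo_X]) auto
    fix z z' assume z: "z \<in> slice s" "z' \<in> slice s" "incomp (le_slice s) z z'"
    have "incomp (le_slice s) (?sh z) (?sh z')"
      using prod_map_incomp[OF sm _ _ z(1,2)] z(3) wo_slice[OF sS] Well_order_oexp_omega by blast
    thus "incomp leX (g z) (g z')" using incomp_same_index[of "g z" "g z'"] g[OF z(1)] g[OF z(2)] by simp
  qed simp
  moreover have "rs ! i \<le>o slice_width s" using rs[of i] i len by (simp add: s_def)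
  ultimately have 1: "rs ! i \<le>o width leX (g ` slice s)" by (rule ordLeq_transitive[rotated])
  have "incomp leX y (g z)" if y: "y \<in> F" and z: "z \<in> slice s" for y z
  proof -
    have "y \<in> (\<Union>j\<in>{i<..<length rs}. {x \<in> X. index x = ss ! j})" using sub y by (rule subsetD)
    then obtain j where "j \<in> {i<..<length rs}" "y \<in> {x \<in> X. index x = ss ! j}" by (rule UN_E)
    hence j: "i < j" "j < length ss" "y \<in> X" "index y = ss ! j" using len by simp_all
    have tG: "index y \<in> ground" using nth_mem[OF j(2)] ss j(4) by simp
    note gz = g[OF z]
    obtain k where k: "k < n" "s k < index y k" using ord[OF j(1,2)] j(4) unfolding s_def by auto
    \<comment> \<open>The enumeration alone settles this direction: in coordinate \<open>k\<close>
      the block of \<open>y\<close> comes after that of \<open>s\<close>. Shifting matters only for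
      the converse.\<close>
    have "(y k, g z k) \<notin> \<alpha> k" using le_X_iff[of y "g z" k] gz j(3) k by simp
    moreover have "\<exists>k<n. (g z k, y k) \<notin> \<alpha> k"
    proof (cases "\<exists>k<n. index y k < s k")
      case True
      then obtain l where "l < n" "index y l < s l" by blast
      thus ?thesis using le_X_iff[of "g z" y l] gz j(3) by auto
    next
      case False
      obtain l where l: "l < n" "index y l = 0" using tG by (auto simp: ground_def)
      hence sl: "s l = 0" using tG False by (metis less_nat_zero_code neq0_conv)
      have wol: "Well_order (E l ! 0)" using wo_slice[OF sS l(1)] sl by simp
      have zl: "z l \<in> fin_supp (E l ! 0)" using z l(1) sl by (auto simp: prod_carrier_def Field_oexp_omega)
      have Nl: "N l \<in> fin_supp (E l ! 0)" using N(1)[OF l(1)] sl by simp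
      have "pos y l \<in> underS (oexp_omega (E l ! 0)) (N l)" using N(2)[OF l(1) sl y l(2)] .
      hence "pos y l \<in> underS (oexp_omega (E l ! 0)) (oadd (N l) (z l))"
        by (rule underS_le_trans[OF Well_order_oexp_omega[OF wol] _ oexp_omega_oadd_self[OF wol zl Nl]])
      hence "(pos (g z) l, pos y l) \<notin> oexp_omega (E l ! 0)"
        using underS_not_ge[OF Well_order_oexp_omega[OF wol]] gz l(1) by (simp add: prod_map_def)
      hence "(g z l, y l) \<notin> \<alpha> l" using le_X_iff[of "g z" y l] gz j(3) l sl by simp
      thus ?thesis using l(1) by blast
    qed
    ultimately show ?thesis using incomp_prod_iff[of y n \<alpha> "g z"] gz j(3) k(1) by blast
  qed
  moreover have "g ` slice s \<subseteq> {x \<in> X. index x = ss ! i}" using g by (auto simp: s_def)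
  ultimately show "\<exists>C\<subseteq>{x \<in> X. index x = ss ! i}. (\<forall>y\<in>F. \<forall>c\<in>C. incomp leX y c) \<and> rs ! i \<le>o width leX C"
    using 1 by (intro exI[of _ "g ` slice s"]) blast
qed

section \<open>The two bounds combined into the natural sum\<close>

lemma natsum_width: "natsum_is ground slice_width (width leX X)"
proof -
  have "\<exists>d :: (nat \<Rightarrow> 'a \<Rightarrow> nat) list set rel. Well_order d \<and> slice_width s =o oexp_omega d" if "s \<in> ground" for s
  proof -
    have wo: "\<forall>i<n. Well_order (E i ! s i)" using wo_slice[OF ground_slices[OF that]] by blast
    obtain d :: "(nat \<Rightarrow> 'a \<Rightarrow> nat) list set rel" where "Well_order d" "slice_width s =o oexp_omega d"
      by (rule width_prod_oexp_omega[OF wo])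
    thus ?thesis by blast
  qed
  hence "\<exists>e :: (nat \<Rightarrow> nat) \<Rightarrow> (nat \<Rightarrow> 'a \<Rightarrow> nat) list set rel.
      \<forall>s\<in>ground. Well_order (e s) \<and> slice_width s =o oexp_omega (e s)"
    by (intro bchoice) blast
  then obtain e :: "(nat \<Rightarrow> nat) \<Rightarrow> (nat \<Rightarrow> 'a \<Rightarrow> nat) list set rel"
    where "\<forall>s\<in>ground. Well_order (e s) \<and> slice_width s =o oexp_omega (e s)" by (rule exE)
  hence e: "\<And>s. s \<in> ground \<Longrightarrow> Well_order (e s)" "\<And>s. s \<in> ground \<Longrightarrow> slice_width s =o oexp_omega (e s)"
    by simp_all
  obtain W :: "(nat \<Rightarrow> 'a \<Rightarrow> nat) list set set rel" where W: "Well_order W" "Field W = UNIV"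
    by (rule ex_Well_order_UNIV)
  let ?O = "oexp_omega W"
  have woO: "Well_order ?O" using Well_order_oexp_omega[OF W(1)] .
  \<comment> \<open>\<open>W\<close> lives one power type above the exponents, so each exponent is
    the segment below a point \<open>p s\<close>, and widths of slices are compared by comparing
    these points.\<close>
  have "\<exists>p. e s =o Restr W (underS W p)" if "s \<in> ground" for s
    using ordLess_Well_order_UNIV_set[OF e(1)[OF that] W] ordLess_iff_ordIso_Restr[OF W(1) e(1)[OF that]] by blast
  then obtain p where p: "\<And>s. s \<in> ground \<Longrightarrow> e s =o Restr W (underS W (p s))" by metis
  have pF: "p s \<in> Field W" for s using W by simp
  have sw: "slice_width s =o Restr ?O (underS ?O (osingle (p s)))" if "s \<in> ground" for s
    using ordIso_transitive[OF e(2)[OF that] oexp_omega_cong[OF p[OF that]]]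
    unfolding oexp_omega_Restr[OF W(1) pF] .
  have p_mono: "(p s, p t) \<in> W" if st: "s \<in> ground" "t \<in> ground" "\<And>i. i < n \<Longrightarrow> t i \<le> s i" for s t
  proof -
    have "slice_width s \<le>o slice_width t" using slice_width_antimono ground_slices st by blast
    hence "Restr ?O (underS ?O (osingle (p s))) \<le>o Restr ?O (underS ?O (osingle (p t)))"
      using sw[OF st(1)] sw[OF st(2)] by (meson ordIso_ordLeq_trans ordIso_symmetric ordLeq_ordIso_trans)
    hence "(osingle (p s), osingle (p t)) \<in> ?O"
      using Restr_underS_ordLeq_iff[OF woO] osingle_fin_supp[OF pF] by (simp add: Field_oexp_omega)
    thus ?thesis using strict_map_iff[OF strict_map_osingle[OF W(1)] W(1) woO pF pF] by simp
  qed
  \<comment> \<open>Wider slices come first. Among slices of equal width the coordinate sum decides,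
    which places a slice before all distinct slices above it.\<close>
  define prec where "prec t s \<longleftrightarrow> p s \<in> underS W (p t) \<or> (p t = p s \<and> sum t {..<n} < sum s {..<n})" for t s
  obtain ss where ss: "set ss = ground" "distinct ss"
    "\<And>i j. i < j \<Longrightarrow> j < length ss \<Longrightarrow> \<not> prec (ss ! j) (ss ! i)"
  proof (rule ex_list_respecting_order[OF finite_ground, of prec])
    show "\<not> prec s s" for s by (simp add: prec_def underS_iff)
    show "prec s u" if "prec s t" "prec t u" for s t u
      using that underS_trans'[OF W(1), of "p u" "p t" "p s"] unfolding prec_def
      by (elim disjE conjE) (simp_all only: simp_thms, metis less_trans)
  qed blast
  have ssG: "ss ! i \<in> ground" if "i < length ss" for i using nth_mem[OF that] ss(1) by simp
  have p_dec: "(p (ss ! j), p (ss ! i)) \<in> W" if "i < j" "j < length ss" for i j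
    using ss(3)[OF that] not_underS_iff[OF W(1) pF pF] unfolding prec_def by blast
  \<comment> \<open>If a later slice were below an earlier one, its width would be at least as
    large, by \<open>p_mono\<close>, and at most as large, by the enumeration. With equal widths its
    smaller coordinate sum should have placed it first.\<close>
  have ord: "\<exists>k<n. (ss ! i) k < (ss ! j) k" if ij: "i < j" "j < length ss" for i j
  proof (rule ccontr)
    assume "\<not> (\<exists>k<n. (ss ! i) k < (ss ! j) k)"
    hence le: "(ss ! j) k \<le> (ss ! i) k" if "k < n" for k using that by (metis not_less)
    have G: "ss ! i \<in> ground" "ss ! j \<in> ground" using ssG ij by auto
    have "(p (ss ! i), p (ss ! j)) \<in> W" using p_mono[OF G le] .
    hence peq: "p (ss ! i) = p (ss ! j)" using p_dec[OF ij] Well_order_antisymD[OF W(1)] by blast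
    have "ss ! i \<noteq> ss ! j" using ss(2) ij by (simp add: nth_eq_iff_index_eq)
    then obtain k where k: "(ss ! i) k \<noteq> (ss ! j) k" by blast
    hence "k < n" using ground_slices[OF G(1)] ground_slices[OF G(2)] unfolding slices_def
      by (metis (mono_tags, lifting) linorder_not_le mem_Collect_eq)
    hence "sum (ss ! j) {..<n} < sum (ss ! i) {..<n}"
      using le k by (intro sum_strict_mono_ex1) (auto intro!: bexI[of _ k] simp: order.strict_iff_order)
    thus False using ss(3)[OF ij] peq unfolding prec_def by simp
  qed
  let ?es = "map e ss"
  \<comment> \<open>The pointwise sum over the ground is read along \<open>ss\<close>; since the
    exponents decrease along this list, it is bounded by the ordinal sum that the lower bound
    attains.\<close>
  have "width leX X \<le>o osum_list (map oexp_omega ?es)"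
  proof -
    have "width leX X \<le>o Restr ?O (underS ?O (\<lambda>x. \<Sum>s\<in>ground. osingle (p s) x))"
      by (rule width_X_upper[OF W(1) pF]) (use sw ordIso_imp_ordLeq in blast)
    also have "(\<lambda>x. \<Sum>s\<in>ground. osingle (p s) x) = osingles (map p ss)"
    proof
      fix x
      have "(\<Sum>s\<in>ground. osingle (p s) x) = sum_list (map (\<lambda>s. osingle (p s) x) ss)"
        using sum.distinct_set_conv_list[OF ss(2), of "\<lambda>s. osingle (p s) x"] ss(1) by simp
      also have "\<dots> = osingles (map p ss) x"
        by (simp add: sum_list_sum_nth osingles_def atLeast0LessThan)
      finally show "(\<Sum>s\<in>ground. osingle (p s) x) = osingles (map p ss) x" .
    qed
    also have "Restr ?O (underS ?O (osingles (map p ss))) \<le>o osum_list (map oexp_omega ?es)"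
    proof (rule underS_osingles_ordLeq_osum_list[OF W(1)])
      show "set (map p ss) \<subseteq> Field W" using W by simp
      show "(map p ss ! j, map p ss ! i) \<in> W" if "i < j" "j < length (map p ss)" for i j
        using p_dec[of i j] that by simp
      show "Restr W (underS W (map p ss ! i)) \<le>o ?es ! i" if "i < length (map p ss)" for i
        using p[OF ssG[of i]] that ordIso_imp_ordLeq ordIso_symmetric by fastforce
    qed simp
    finally show ?thesis .
  qed
  moreover have "osum_list (map oexp_omega ?es) \<le>o width leX X"
  proof (rule width_X_lower[OF ss(1) ord])
    show "map oexp_omega ?es ! i \<le>o slice_width (ss ! i)" if "i < length ss" for i
      using e(2)[OF ssG[OF that]] ordIso_imp_ordLeq ordIso_symmetric that by fastforce
  qed simp_all
  ultimately have iso: "width leX X =o osum_list (map oexp_omega ?es)" by (simp add: ordIso_iff_ordLeq)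
  \<comment> \<open>Each width is a single power, so its normal form has one term and the merged
    multiset of exponents is just that of \<open>?es\<close>.\<close>
  have cnf: "cnf (slice_width s) [e s]" if "s \<in> ground" for s
    using e(1)[OF that] ordIso_transitive[OF e(2)[OF that] osum_list_singleton[OF Well_order_oexp_omega[OF e(1)[OF that]]]]
    by (simp add: cnf_def)
  have ms: "mset ?es = (\<Sum>s\<in>ground. mset [e s])"
    using ss(1,2) by (simp add: sum_unfold_sum_mset mset_set_set flip: ss(1))
  have dec: "?es ! Suc k \<le>o ?es ! k" if "Suc k < length ?es" for k
  proof -
    have k: "Suc k < length ss" "k < length ss" using that by auto
    have "Restr W (underS W (p (ss ! Suc k))) \<le>o Restr W (underS W (p (ss ! k)))"
      using Restr_underS_ordLeq_iff[OF W(1) pF pF] p_dec[OF lessI k(1)] by blast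
    hence "e (ss ! Suc k) \<le>o e (ss ! k)"
      using p[OF ssG[OF k(1)]] p[OF ssG[OF k(2)]]
      by (meson ordIso_ordLeq_trans ordIso_symmetric ordLeq_ordIso_trans)
    thus ?thesis using k by simp
  qed
  have woe: "\<forall>d\<in>set ?es. Well_order d" using e(1) ss(1) by auto
  show ?thesis
    unfolding natsum_is_def
    by (rule exI[of _ "\<lambda>s. [e s]"], rule exI[of _ ?es]) (use cnf ms woe dec iso in blast)
qed

end

theorem mainTheorem11:
  fixes n :: nat and \<alpha> :: "nat \<Rightarrow> 'a rel" and E :: "nat \<Rightarrow> 'a rel list"
  assumes "n \<ge> 1"
    and "\<forall>i<n. Well_order (\<alpha> i) \<and> infinite (Field (\<alpha> i))"
    and "\<forall>i<n. cnf (\<alpha> i) (E i)"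
  shows "natsum_is
     {s. (\<forall>i<n. s i < length (E i)) \<and> (\<forall>i\<ge>n. s i = 0) \<and> (\<exists>k<n. s k = 0)}
     (\<lambda>s. width (prod_le n (\<lambda>i. oexp_omega (E i ! s i)))
                 (prod_carrier n (\<lambda>i. oexp_omega (E i ! s i))))
     (width (prod_le n \<alpha>) (prod_carrier n \<alpha>))"
proof -
  have "\<exists>f. iso (\<alpha> i) (osum_list (map oexp_omega (E i))) f" if "i < n" for i
    using assms(3) that unfolding cnf_def ordIso_def by auto
  then obtain h where h: "\<And>i. i < n \<Longrightarrow> iso (\<alpha> i) (osum_list (map oexp_omega (E i))) (h i)" by metis
  interpret sliced_product n \<alpha> E h
  proof
    show "Well_order (E i ! j)" if "i < n" "j < length (E i)" for i j
      using assms(3) that unfolding cnf_def by simp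
    show "E i ! Suc k \<le>o E i ! k" if "i < n" "Suc k < length (E i)" for i k
      using assms(3) that unfolding cnf_def by simp
  qed (use assms(1,2) h in simp_all)
  have "ground = {s. (\<forall>i<n. s i < length (E i)) \<and> (\<forall>i\<ge>n. s i = 0) \<and> (\<exists>k<n. s k = 0)}"
    by (auto simp: ground_def slices_def)
  thus ?thesis using natsum_width by simp
qed

end
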